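(* Let $\phi:\mathcal{H}\to\mathbb{C}$ be a Lie algebra homomorphism such that $\phi(p)\neq 0$ or $\phi(q)\neq 0$, and let $V$ be a simple quasi-Whittaker module of type $\phi$ for $\mathfrak{S}$. Then $V\cong L_{\phi,\xi}$ for some $\xi\in\mathbb{C}$.
   Context: The Schrödinger algebra $\mathfrak{S}$ is the complex Lie algebra with basis $e,h,f,p,q,z$ and brackets $[h,e]=2e$, $[h,f]=-2f$, $[e,f]=h$, $[h,p]=p$, $[h,q]=-q$, $[p,q]=z$, $[e,q]=p$, $[p,f]=-q$, $[f,q]=0$, $[e,p]=0$, $[z,\mathfrak{S}]=0$. Its Heisenberg subalgebra is $\mathcal{H}=\mathrm{span}_{\mathbb{C}}\{p,q,z\}$. For a Lie algebra homomorphism $\phi:\mathcal{H}\to\mathbb{C}$ (so $\phi(z)=0$) and an $\mathfrak{S}$-module $V$, a nonzero vector $v\in V$ is a quasi-Whittaker vector of type $\phi$ if $xv=\phi(x)v$ for all $x\in\mathcal{H}$. $V$ is a quasi-Whittaker module of type $\phi$ if it contains a cyclic quasi-Whittaker vector $v$ of type $\phi$, i.e. one with $V=\mathcal{U}(\mathfrak{S})v$. For $\phi\neq 0$, the universal quasi-Whittaker module of type $\phi$ is $M_\phi=\mathcal{U}(\mathfrak{S})\otimes_{\mathcal{U}(\mathcal{H})}\mathbb{C}_\phi$, where $\mathbb{C}_\phi=\mathbb{C}w$ is the one-dimensional $\mathcal{H}$-module with $xw=\phi(x)w$ for $x\in\mathcal{H}$; write $w$ also for its cyclic vector $1\otimes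 w$. Put $C=\phi(p)^2f-\phi(q)^2e-\phi(p)\phi(q)h\in\mathcal{U}(\mathfrak{S})$. For $\xi\in\mathbb{C}$ put $W_{\phi,\xi}=\mathcal{U}(\mathfrak{S})(C-\xi)w\subseteq M_\phi$ and $L_{\phi,\xi}=M_\phi/W_{\phi,\xi}$. *)

theory Defs
  imports Complex_Main "HOL-Algebra.Module" "HOL-Algebra.AbelCoset"
    "HOL-Algebra.Free_Abelian_Groups" "HOL-Library.Poly_Mapping"
begin

section \<open>Complex Lie algebras\<close>

class complex_lie_algebra = ab_group_add +
  fixes cscale :: "complex \<Rightarrow> 'a \<Rightarrow> 'a"  (infixr \<open>*\<^sub>C\<close> 75)
    and bracket :: "'a \<Rightarrow> 'a \<Rightarrow> 'a"
  assumes cscale_add_right: "c *\<^sub>C (x + y) = c *\<^sub>C x + c *\<^sub>C y"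
    and cscale_add_left: "(c + d) *\<^sub>C x = c *\<^sub>C x + d *\<^sub>C x"
    and cscale_cscale: "c *\<^sub>C (d *\<^sub>C x) = (c * d) *\<^sub>C x"
    and cscale_one: "1 *\<^sub>C x = x"
    and bracket_add_left: "bracket (x + y) u = bracket x u + bracket y u"
    and bracket_add_right: "bracket u (x + y) = bracket u x + bracket u y"
    and bracket_cscale_left: "bracket (c *\<^sub>C x) y = c *\<^sub>C bracket x y"
    and bracket_cscale_right: "bracket x (c *\<^sub>C y) = c *\<^sub>C bracket x y"
    and bracket_self: "bracket x x = 0"
    and jacobi: "bracket x (bracket y u) + bracket y (bracket u x) + bracket u (bracket x y) = 0"

definition lie_hom :: "('a::complex_lie_algebra \<Rightarrow> 'b::complex_lie_algebra) \<Rightarrow> bool" where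
  "lie_hom f \<longleftrightarrow>
     (\<forall>x y. f (x + y) = f x + f y) \<and>
     (\<forall>c x. f (c *\<^sub>C x) = c *\<^sub>C f x) \<and>
     (\<forall>x y. f (bracket x y) = bracket (f x) (f y))"

text \<open>The one-dimensional abelian Lie algebra.\<close>

instantiation complex :: complex_lie_algebra
begin
definition cscale_complex :: "complex \<Rightarrow> complex \<Rightarrow> complex"
  where "cscale_complex c x = c * x"
definition bracket_complex :: "complex \<Rightarrow> complex \<Rightarrow> complex"
  where "bracket_complex x y = 0"
instance
  by standard (simp_all add: cscale_complex_def bracket_complex_def algebra_simps)
end


section \<open>The Schroedinger algebra and its Heisenberg subalgebra\<close>

text \<open>An element is given by its coordinates with respect to the basis \<open>e, h, f, p, q, z\<close>.
  The bracket in coordinates is the bilinear alternating extension of the brackets of the basis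
  vectors, which are listed in the lemma \<open>schroedinger_brackets\<close> below.\<close>

datatype schroedinger = Sch (co_e: complex) (co_h: complex) (co_f: complex)
                            (co_p: complex) (co_q: complex) (co_z: complex)

instantiation schroedinger :: complex_lie_algebra
begin

definition "0 = Sch 0 0 0 0 0 0"

definition "x + y = Sch (co_e x + co_e y) (co_h x + co_h y) (co_f x + co_f y)
                        (co_p x + co_p y) (co_q x + co_q y) (co_z x + co_z y)"

definition "- x = Sch (- co_e x) (- co_h x) (- co_f x) (- co_p x) (- co_q x) (- co_z x)"

definition "x - (y::schroedinger) = x + (- y)"

definition "c *\<^sub>C x = Sch (c * co_e x) (c * co_h x) (c * co_f x)
                         (c * co_p x) (c * co_q x) (c * co_z x)"

definition "bracket x y = Sch
   (2 * (co_h x * co_e y - co_e x * co_h y))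
   (co_e x * co_f y - co_f x * co_e y)
   (- 2 * (co_h x * co_f y - co_f x * co_h y))
   ((co_h x * co_p y - co_p x * co_h y) + (co_e x * co_q y - co_q x * co_e y))
   (- (co_h x * co_q y - co_q x * co_h y) - (co_p x * co_f y - co_f x * co_p y))
   (co_p x * co_q y - co_q x * co_p y)"

instance
  by standard
    (simp_all add: zero_schroedinger_def plus_schroedinger_def uminus_schroedinger_def
      minus_schroedinger_def cscale_schroedinger_def bracket_schroedinger_def algebra_simps)

end

definition sch_e :: schroedinger where "sch_e = Sch 1 0 0 0 0 0"
definition sch_h :: schroedinger where "sch_h = Sch 0 1 0 0 0 0"
definition sch_f :: schroedinger where "sch_f = Sch 0 0 1 0 0 0"
definition sch_p :: schroedinger where "sch_p = Sch 0 0 0 1 0 0"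
definition sch_q :: schroedinger where "sch_q = Sch 0 0 0 0 1 0"
definition sch_z :: schroedinger where "sch_z = Sch 0 0 0 0 0 1"

lemma schroedinger_brackets:
  "bracket sch_h sch_e = 2 *\<^sub>C sch_e"
  "bracket sch_h sch_f = (- 2) *\<^sub>C sch_f"
  "bracket sch_e sch_f = sch_h"
  "bracket sch_h sch_p = sch_p"
  "bracket sch_h sch_q = - sch_q"
  "bracket sch_p sch_q = sch_z"
  "bracket sch_e sch_q = sch_p"
  "bracket sch_p sch_f = - sch_q"
  "bracket sch_f sch_q = 0"
  "bracket sch_e sch_p = 0"
  "bracket sch_z x = 0"
  by (simp_all add: sch_e_def sch_h_def sch_f_def sch_p_def sch_q_def sch_z_def
      bracket_schroedinger_def cscale_schroedinger_def zero_schroedinger_def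
      uminus_schroedinger_def)

lemma schroedinger_basis:
  "x = co_e x *\<^sub>C sch_e + co_h x *\<^sub>C sch_h + co_f x *\<^sub>C sch_f
     + co_p x *\<^sub>C sch_p + co_q x *\<^sub>C sch_q + co_z x *\<^sub>C sch_z"
  by (simp add: sch_e_def sch_h_def sch_f_def sch_p_def sch_q_def sch_z_def
      plus_schroedinger_def cscale_schroedinger_def)

typedef heisenberg =
  "{x :: schroedinger. \<exists>a b c. x = a *\<^sub>C sch_p + b *\<^sub>C sch_q + c *\<^sub>C sch_z}"
  morphisms heis_incl Abs_heisenberg
  by blast

lemma heisenberg_span_iff:
  "(\<exists>a b c. x = a *\<^sub>C sch_p + b *\<^sub>C sch_q + c *\<^sub>C sch_z) \<longleftrightarrow>
     co_e x = 0 \<and> co_h x = 0 \<and> co_f x = 0"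
  by (cases x) (auto simp: sch_p_def sch_q_def sch_z_def
      plus_schroedinger_def cscale_schroedinger_def)

setup_lifting type_definition_heisenberg

instantiation heisenberg :: complex_lie_algebra
begin

lift_definition zero_heisenberg :: heisenberg is 0
  unfolding heisenberg_span_iff by (simp add: zero_schroedinger_def)

lift_definition plus_heisenberg :: "heisenberg \<Rightarrow> heisenberg \<Rightarrow> heisenberg" is "(+)"
  unfolding heisenberg_span_iff by (simp add: plus_schroedinger_def)

lift_definition uminus_heisenberg :: "heisenberg \<Rightarrow> heisenberg" is uminus
  unfolding heisenberg_span_iff by (simp add: uminus_schroedinger_def)

lift_definition minus_heisenberg :: "heisenberg \<Rightarrow> heisenberg \<Rightarrow> heisenberg" is "(-)"
  unfolding heisenberg_span_iff
  by (simp add: minus_schroedinger_def plus_schroedinger_def uminus_schroedinger_def)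

lift_definition cscale_heisenberg :: "complex \<Rightarrow> heisenberg \<Rightarrow> heisenberg" is "(*\<^sub>C)"
  unfolding heisenberg_span_iff by (simp add: cscale_schroedinger_def)

lift_definition bracket_heisenberg :: "heisenberg \<Rightarrow> heisenberg \<Rightarrow> heisenberg" is bracket
  unfolding heisenberg_span_iff by (simp add: bracket_schroedinger_def)

instance
  by standard
    (transfer; simp add: cscale_add_right cscale_add_left cscale_cscale cscale_one
      bracket_add_left bracket_add_right bracket_cscale_left bracket_cscale_right
      bracket_self jacobi)+

end

lift_definition heis_p :: heisenberg is sch_p
  unfolding heisenberg_span_iff by (simp add: sch_p_def)
lift_definition heis_q :: heisenberg is sch_q
  unfolding heisenberg_span_iff by (simp add: sch_q_def)
lift_definition heis_z :: heisenberg is sch_z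
  unfolding heisenberg_span_iff by (simp add: sch_z_def)


section \<open>The universal enveloping algebra\<close>

text \<open>Lists, made into a type of class \<open>monoid_add\<close> by concatenation: with these as exponents,
  the type \<open>_ \<Rightarrow>\<^sub>0 complex\<close> of polynomial mappings is the free associative
  unital algebra on the elements of \<^typ>\<open>'a\<close>.\<close>

datatype 'a word = Word (letters: "'a list")

instantiation word :: (type) monoid_add
begin
definition "0 = Word []"
definition "u + v = Word (letters u @ letters v)"
instance by standard (simp_all add: zero_word_def plus_word_def)
end

type_synonym 'a free_alg = "'a word \<Rightarrow>\<^sub>0 complex"

definition free_const :: "complex \<Rightarrow> 'a free_alg" where
  "free_const c = Poly_Mapping.single 0 c"

definition free_gen :: "'a \<Rightarrow> 'a free_alg" where
  "free_gen x = Poly_Mapping.single (Word [x]) 1"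

text \<open>The free algebra on the underlying set of \<^typ>\<open>'a\<close> modulo the two families of linearity
  relations is the tensor algebra, and the third family are the relations
  \<open>x \<otimes> y - y \<otimes> x - [x, y]\<close>.\<close>

inductive_set uea_rels :: "'a::complex_lie_algebra free_alg set" where
  "free_gen (x + y) - free_gen x - free_gen y \<in> uea_rels"
| "free_gen (c *\<^sub>C x) - free_const c * free_gen x \<in> uea_rels"
| "free_gen x * free_gen y - free_gen y * free_gen x - free_gen (bracket x y) \<in> uea_rels"

text \<open>The two-sided ideal generated by the relations.\<close>

inductive_set uea_ideal :: "'a::complex_lie_algebra free_alg set" where
  uea_ideal_zero: "0 \<in> uea_ideal"
| uea_ideal_add: "r \<in> uea_rels \<Longrightarrow> s \<in> uea_ideal \<Longrightarrow> a * r * b + s \<in> uea_ideal"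

lemma uea_ideal_plus: "s \<in> uea_ideal \<Longrightarrow> t \<in> uea_ideal \<Longrightarrow> s + t \<in> uea_ideal"
  by (induction rule: uea_ideal.induct) (auto intro: uea_ideal.intros simp: add.assoc)

lemma uea_ideal_mult_left: "s \<in> uea_ideal \<Longrightarrow> c * s \<in> uea_ideal"
proof (induction rule: uea_ideal.induct)
  case (uea_ideal_add r s a b)
  have "(c * a) * r * b + c * s \<in> uea_ideal"
    using uea_ideal_add by (intro uea_ideal.intros)
  then show ?case by (simp add: algebra_simps)
qed (simp add: uea_ideal.intros)

lemma uea_ideal_mult_right: "s \<in> uea_ideal \<Longrightarrow> s * c \<in> uea_ideal"
proof (induction rule: uea_ideal.induct)
  case (uea_ideal_add r s a b)
  have "a * r * (b * c) + s * c \<in> uea_ideal"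
    using uea_ideal_add by (intro uea_ideal.intros)
  then show ?case by (simp add: algebra_simps)
qed (simp add: uea_ideal.intros)

lemma uea_ideal_uminus: "s \<in> uea_ideal \<Longrightarrow> - s \<in> uea_ideal"
  using uea_ideal_mult_left[of s "- 1"] by simp

text \<open>The ideal is proper: it lies in the kernel of the augmentation.\<close>

lemma word_zero_eq_plus_iff: "(0 :: 'a word) = u + v \<longleftrightarrow> u = 0 \<and> v = 0"
  by (cases u; cases v) (auto simp: zero_word_def plus_word_def)

lemma lookup_zero_mult:
  "Poly_Mapping.lookup (s * t) 0 = Poly_Mapping.lookup s 0 * Poly_Mapping.lookup t 0"
  for s t :: "'a free_alg"
proof -
  have 1: "(\<Sum>q. Poly_Mapping.lookup t q when 0 = l + q) = (Poly_Mapping.lookup t 0 when l = 0)"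
    for l :: "'a word"
    by (cases "l = 0") (simp_all add: word_zero_eq_plus_iff)
  have "Poly_Mapping.lookup (s * t) 0 =
      (\<Sum>l. Poly_Mapping.lookup s l * (\<Sum>q. Poly_Mapping.lookup t q when 0 = l + q))"
    by (simp add: times_poly_mapping.rep_eq prod_fun_def)
  also have "\<dots> = (\<Sum>l. (Poly_Mapping.lookup s l * Poly_Mapping.lookup t 0) when l = 0)"
    unfolding 1 by (simp add: mult_when)
  also have "\<dots> = Poly_Mapping.lookup s 0 * Poly_Mapping.lookup t 0"
    by simp
  finally show ?thesis .
qed

lemma uea_ideal_augmentation: "s \<in> uea_ideal \<Longrightarrow> Poly_Mapping.lookup s 0 = 0"
proof (induction rule: uea_ideal.induct)
  case (uea_ideal_add r s a b)
  have gen: "Poly_Mapping.lookup (free_gen x) 0 = 0" for x :: 'a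
    by (simp add: free_gen_def lookup_single zero_word_def)
  have "Poly_Mapping.lookup r 0 = 0"
    using uea_ideal_add(1)
    by (cases rule: uea_rels.cases) (simp_all add: lookup_minus lookup_zero_mult gen)
  then show ?case
    using uea_ideal_add by (simp add: lookup_add lookup_zero_mult)
qed simp

quotient_type (overloaded) 'a uea =
  "'a::complex_lie_algebra free_alg" / "\<lambda>s t. s - t \<in> uea_ideal"
proof (rule equivpI)
  show "reflp (\<lambda>s t. s - t \<in> uea_ideal)"
    by (auto intro!: reflpI simp: uea_ideal_zero)
  show "symp (\<lambda>s t. s - t \<in> uea_ideal)"
    using uea_ideal_uminus by (fastforce intro: sympI)
  show "transp (\<lambda>s t. s - t \<in> uea_ideal)"
    using uea_ideal_plus by (fastforce intro: transpI)
qed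

instantiation uea :: (complex_lie_algebra) ring_1
begin

lift_definition zero_uea :: "'a uea" is 0 .

lift_definition one_uea :: "'a uea" is 1 .

lift_definition plus_uea :: "'a uea \<Rightarrow> 'a uea \<Rightarrow> 'a uea" is "(+)"
  by (metis add_diff_add uea_ideal_plus)

lift_definition uminus_uea :: "'a uea \<Rightarrow> 'a uea" is uminus
  by (metis minus_diff_minus uea_ideal_uminus)

lift_definition minus_uea :: "'a uea \<Rightarrow> 'a uea \<Rightarrow> 'a uea" is "(-)"
proof -
  fix s s' t t' :: "'a free_alg"
  assume "s - s' \<in> uea_ideal" "t - t' \<in> uea_ideal"
  then have "(s - s') + - (t - t') \<in> uea_ideal"
    by (intro uea_ideal_plus uea_ideal_uminus)
  then show "s - t - (s' - t') \<in> uea_ideal"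
    by (simp add: algebra_simps)
qed

lift_definition times_uea :: "'a uea \<Rightarrow> 'a uea \<Rightarrow> 'a uea" is "(*)"
proof -
  fix s s' t t' :: "'a free_alg"
  assume "s - s' \<in> uea_ideal" "t - t' \<in> uea_ideal"
  then have "(s - s') * t + s' * (t - t') \<in> uea_ideal"
    by (intro uea_ideal_plus uea_ideal_mult_left uea_ideal_mult_right)
  then show "s * t - s' * t' \<in> uea_ideal"
    by (simp add: algebra_simps)
qed

instance
proof
  show "(0::'a uea) \<noteq> 1"
  proof (transfer, rule notI)
    assume "(0::'a free_alg) - 1 \<in> uea_ideal"
    from uea_ideal_augmentation[OF this] show False
      by (simp add: lookup_minus)
  qed
qed (transfer; simp add: algebra_simps uea_ideal_zero)+

end

lift_definition uea_const :: "complex \<Rightarrow> 'a::complex_lie_algebra uea" is free_const .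

lift_definition uea_gen :: "'a::complex_lie_algebra \<Rightarrow> 'a uea" is free_gen .

text \<open>The algebra homomorphism of enveloping algebras induced by a Lie algebra homomorphism;
  meaningless if \<open>f\<close> is not one.\<close>

definition free_map :: "('a \<Rightarrow> 'b) \<Rightarrow> 'a free_alg \<Rightarrow> 'b free_alg" where
  "free_map f t = (\<Sum>w\<in>Poly_Mapping.keys t.
     Poly_Mapping.single (map_word f w) (Poly_Mapping.lookup t w))"

definition uea_map ::
    "('a::complex_lie_algebra \<Rightarrow> 'b::complex_lie_algebra) \<Rightarrow> 'a uea \<Rightarrow> 'b uea" where
  "uea_map f u = abs_uea (free_map f (rep_uea u))"


section \<open>Modules over Lie algebras\<close>

definition complex_ring :: "complex ring" where
  "complex_ring = \<lparr>carrier = UNIV, monoid.mult = (*), one = 1, ring.zero = 0, add = (+)\<rparr>"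

text \<open>The fields \<open>mult\<close> and \<open>one\<close> inherited from \<open>ring\<close> play no role.\<close>

record ('l, 'v) lie_module = "(complex, 'v) module" +
  act :: "'l \<Rightarrow> 'v \<Rightarrow> 'v"

locale lie_module = module complex_ring V
  for V :: "('l::complex_lie_algebra, 'v) lie_module" (structure) +
  assumes act_closed: "v \<in> carrier V \<Longrightarrow> act V x v \<in> carrier V"
    and act_add_left: "v \<in> carrier V \<Longrightarrow> act V (x + y) v = act V x v \<oplus> act V y v"
    and act_cscale_left: "v \<in> carrier V \<Longrightarrow> act V (c *\<^sub>C x) v = c \<odot> act V x v"
    and act_add_right:
      "v \<in> carrier V \<Longrightarrow> v' \<in> carrier V \<Longrightarrow> act V x (v \<oplus> v') = act V x v \<oplus> act V x v'"
    and act_smult_right: "v \<in> carrier V \<Longrightarrow> act V x (c \<odot> v) = c \<odot> act V x v"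
    and act_bracket:
      "v \<in> carrier V \<Longrightarrow> act V (bracket x y) v = act V x (act V y v) \<ominus> act V y (act V x v)"

definition lie_submodule :: "'v set \<Rightarrow> ('l, 'v) lie_module \<Rightarrow> bool" where
  "lie_submodule N V \<longleftrightarrow>
     submodule N complex_ring V \<and> (\<forall>x. \<forall>v\<in>N. act V x v \<in> N)"

definition simple_lie_module :: "('l, 'v) lie_module \<Rightarrow> bool" where
  "simple_lie_module V \<longleftrightarrow>
     carrier V \<noteq> {\<zero>\<^bsub>V\<^esub>} \<and>
     (\<forall>N. lie_submodule N V \<longrightarrow> N = {\<zero>\<^bsub>V\<^esub>} \<or> N = carrier V)"

definition lie_module_iso ::
    "('v \<Rightarrow> 'w) \<Rightarrow> ('l, 'v) lie_module \<Rightarrow> ('l, 'w) lie_module \<Rightarrow> bool" where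
  "lie_module_iso T V W \<longleftrightarrow>
     bij_betw T (carrier V) (carrier W) \<and>
     (\<forall>v\<in>carrier V. \<forall>v'\<in>carrier V. T (v \<oplus>\<^bsub>V\<^esub> v') = T v \<oplus>\<^bsub>W\<^esub> T v') \<and>
     (\<forall>c. \<forall>v\<in>carrier V. T (c \<odot>\<^bsub>V\<^esub> v) = c \<odot>\<^bsub>W\<^esub> T v) \<and>
     (\<forall>x. \<forall>v\<in>carrier V. T (act V x v) = act W x (T v))"

definition lie_module_isomorphic ::
    "('l, 'v) lie_module \<Rightarrow> ('l, 'w) lie_module \<Rightarrow> bool"  (infix \<open>\<cong>\<^sub>L\<close> 50) where
  "V \<cong>\<^sub>L W \<longleftrightarrow> (\<exists>T. lie_module_iso T V W)"

text \<open>Quotient by a subgroup stable under all the operations.  All members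
  of each of the unions are then the same coset.\<close>

definition quot_lie_module ::
    "('l, 'v) lie_module \<Rightarrow> 'v set \<Rightarrow> ('l, 'v set) lie_module"  (infixl \<open>'/\<^sub>L\<close> 65) where
  "V /\<^sub>L N =
     \<lparr>carrier = a_rcosets\<^bsub>V\<^esub> N, monoid.mult = undefined, one = undefined, ring.zero = N,
      add = (<+>\<^bsub>V\<^esub>),
      smult = (\<lambda>c X. \<Union>v\<in>X. N +>\<^bsub>V\<^esub> (c \<odot>\<^bsub>V\<^esub> v)),
      act = (\<lambda>x X. \<Union>v\<in>X. N +>\<^bsub>V\<^esub> act V x v)\<rparr>"

text \<open>On a module the relations act by zero, so the representative does not matter.\<close>

definition word_act :: "('l, 'v) lie_module \<Rightarrow> 'l word \<Rightarrow> 'v \<Rightarrow> 'v" where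
  "word_act V w v = foldr (act V) (letters w) v"

definition free_act :: "('l, 'v) lie_module \<Rightarrow> 'l free_alg \<Rightarrow> 'v \<Rightarrow> 'v" where
  "free_act V t v =
     (\<Oplus>\<^bsub>V\<^esub>w\<in>Poly_Mapping.keys t. Poly_Mapping.lookup t w \<odot>\<^bsub>V\<^esub> word_act V w v)"

definition uea_act ::
    "('l::complex_lie_algebra, 'v) lie_module \<Rightarrow> 'l uea \<Rightarrow> 'v \<Rightarrow> 'v" where
  "uea_act V u v = free_act V (rep_uea u) v"

definition cyclic_submodule :: "('l::complex_lie_algebra, 'v) lie_module \<Rightarrow> 'v \<Rightarrow> 'v set" where
  "cyclic_submodule V v = range (\<lambda>u. uea_act V u v)"


section \<open>Induced modules\<close>

text \<open>For a homomorphism \<open>\<iota> : \<aa> \<rightarrow> \<gg>\<close> of Lie algebras and an \<open>\<aa>\<close>-module \<open>N\<close>, the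
  \<open>\<gg>\<close>-module \<open>U(\<gg>) \<otimes>\<^bsub>U(\<aa>)\<^esub> N\<close>, where \<open>U(\<aa>)\<close> acts on \<open>U(\<gg>)\<close> from the right via \<open>\<iota>\<close>:
  the quotient of the free abelian group on \<open>U(\<gg>) \<times> N\<close> by the tensor relations, on which
  \<open>U(\<gg>)\<close> (and with it the scalars and \<open>\<gg>\<close>) acts by left multiplication on the first factor.\<close>

inductive_set tensor_rels ::
    "('a::complex_lie_algebra \<Rightarrow> 'g::complex_lie_algebra) \<Rightarrow> ('a, 'n) lie_module \<Rightarrow>
     ('g uea \<times> 'n \<Rightarrow>\<^sub>0 int) set"
  for \<iota> :: "'a \<Rightarrow> 'g" and N :: "('a, 'n) lie_module" where
  "n \<in> carrier N \<Longrightarrow>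
     frag_of (u + u', n) - frag_of (u, n) - frag_of (u', n) \<in> tensor_rels \<iota> N"
| "n \<in> carrier N \<Longrightarrow> n' \<in> carrier N \<Longrightarrow>
     frag_of (u, n \<oplus>\<^bsub>N\<^esub> n') - frag_of (u, n) - frag_of (u, n') \<in> tensor_rels \<iota> N"
| "n \<in> carrier N \<Longrightarrow>
     frag_of (u * uea_map \<iota> a, n) - frag_of (u, uea_act N a n) \<in> tensor_rels \<iota> N"

definition tensor_kernel ::
    "('a::complex_lie_algebra \<Rightarrow> 'g::complex_lie_algebra) \<Rightarrow> ('a, 'n) lie_module \<Rightarrow>
     ('g uea \<times> 'n \<Rightarrow>\<^sub>0 int) set" where
  "tensor_kernel \<iota> N =
     generate (free_Abelian_group (UNIV \<times> carrier N)) (tensor_rels \<iota> N)"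

definition uea_lmult :: "'g::complex_lie_algebra uea \<Rightarrow>
    ('g uea \<times> 'n \<Rightarrow>\<^sub>0 int) \<Rightarrow> ('g uea \<times> 'n \<Rightarrow>\<^sub>0 int)" where
  "uea_lmult a = frag_extend (\<lambda>(u, n). frag_of (a * u, n))"

text \<open>Not yet a module, since \<open>uea_lmult\<close> is not additive in its first argument.\<close>

definition tensor_pre :: "('a, 'n) lie_module \<Rightarrow>
    ('g::complex_lie_algebra, 'g uea \<times> 'n \<Rightarrow>\<^sub>0 int) lie_module" where
  "tensor_pre N =
     \<lparr>carrier = {t. Poly_Mapping.keys t \<subseteq> UNIV \<times> carrier N},
      monoid.mult = undefined, one = undefined, ring.zero = 0, add = (+),
      smult = (\<lambda>c. uea_lmult (uea_const c)),
      act = (\<lambda>x. uea_lmult (uea_gen x))\<rparr>"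

definition induced_module ::
    "('a::complex_lie_algebra \<Rightarrow> 'g::complex_lie_algebra) \<Rightarrow> ('a, 'n) lie_module \<Rightarrow>
     ('g, ('g uea \<times> 'n \<Rightarrow>\<^sub>0 int) set) lie_module" where
  "induced_module \<iota> N = tensor_pre N /\<^sub>L tensor_kernel \<iota> N"

definition pure_tensor ::
    "('a::complex_lie_algebra \<Rightarrow> 'g::complex_lie_algebra) \<Rightarrow> ('a, 'n) lie_module \<Rightarrow>
     'g uea \<Rightarrow> 'n \<Rightarrow> ('g uea \<times> 'n \<Rightarrow>\<^sub>0 int) set" where
  "pure_tensor \<iota> N u n =
     tensor_kernel \<iota> N +>\<^bsub>(tensor_pre N :: ('g, _) lie_module)\<^esub> frag_of (u, n)"


section \<open>Quasi-Whittaker modules\<close>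

definition quasi_whittaker_vector ::
    "(heisenberg \<Rightarrow> complex) \<Rightarrow> (schroedinger, 'v) lie_module \<Rightarrow> 'v \<Rightarrow> bool" where
  "quasi_whittaker_vector \<phi> V v \<longleftrightarrow>
     v \<in> carrier V \<and> v \<noteq> \<zero>\<^bsub>V\<^esub> \<and> (\<forall>x. act V (heis_incl x) v = \<phi> x \<odot>\<^bsub>V\<^esub> v)"

definition quasi_whittaker_module ::
    "(heisenberg \<Rightarrow> complex) \<Rightarrow> (schroedinger, 'v) lie_module \<Rightarrow> bool" where
  "quasi_whittaker_module \<phi> V \<longleftrightarrow>
     lie_module V \<and> (\<exists>v. quasi_whittaker_vector \<phi> V v \<and> carrier V = cyclic_submodule V v)"

definition one_dim_module :: "(heisenberg \<Rightarrow> complex) \<Rightarrow> (heisenberg, complex) lie_module" where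
  "one_dim_module \<phi> =
     \<lparr>carrier = UNIV, monoid.mult = undefined, one = undefined, ring.zero = 0, add = (+),
      smult = (*), act = (\<lambda>x c. \<phi> x * c)\<rparr>"

type_synonym univ_qw_carrier = "(schroedinger uea \<times> complex \<Rightarrow>\<^sub>0 int) set"

definition universal_qw_module ::
    "(heisenberg \<Rightarrow> complex) \<Rightarrow> (schroedinger, univ_qw_carrier) lie_module" where
  "universal_qw_module \<phi> = induced_module heis_incl (one_dim_module \<phi>)"

definition universal_qw_vector :: "(heisenberg \<Rightarrow> complex) \<Rightarrow> univ_qw_carrier" where
  "universal_qw_vector \<phi> = pure_tensor heis_incl (one_dim_module \<phi>) 1 1"

definition qw_C :: "(heisenberg \<Rightarrow> complex) \<Rightarrow> schroedinger uea" where
  "qw_C \<phi> = uea_const ((\<phi> heis_p)\<^sup>2) * uea_gen sch_f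
           - uea_const ((\<phi> heis_q)\<^sup>2) * uea_gen sch_e
           - uea_const (\<phi> heis_p * \<phi> heis_q) * uea_gen sch_h"

definition qw_W :: "(heisenberg \<Rightarrow> complex) \<Rightarrow> complex \<Rightarrow> univ_qw_carrier set" where
  "qw_W \<phi> \<xi> = cyclic_submodule (universal_qw_module \<phi>)
     (uea_act (universal_qw_module \<phi>) (qw_C \<phi> - uea_const \<xi>) (universal_qw_vector \<phi>))"

definition qw_L ::
    "(heisenberg \<Rightarrow> complex) \<Rightarrow> complex \<Rightarrow> (schroedinger, univ_qw_carrier set) lie_module" where
  "qw_L \<phi> \<xi> = universal_qw_module \<phi> /\<^sub>L qw_W \<phi> \<xi>"

end

theory Submission
  imports Defs "HOL-Computational_Algebra.Fundamental_Theorem_Algebra"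
begin

text \<open>
  Put \<open>a = \<phi> p\<close> and \<open>b = \<phi> q\<close>, and choose \<open>\<alpha>\<close>, \<open>\<beta>\<close> with \<open>\<alpha> a + \<beta> b = 1\<close>.  The group \<open>SL\<^sub>2\<close> acts on the
  Schroedinger algebra by automorphisms; the one with \<open>p \<mapsto> P = \<alpha> p + \<beta> q\<close> and
  \<open>q \<mapsto> Q = a q - b p\<close> sends \<open>f\<close> to \<open>C\<close>.  In the new basis \<open>E, H, F = C, P, Q, Z\<close> the
  homomorphism is given by \<open>P \<mapsto> 1\<close>, \<open>Q \<mapsto> 0\<close>, \<open>Z \<mapsto> 0\<close>
  (\<open>schroedinger_basis_rotated\<close>).

  All modules concerned are cyclic, that is, of the form \<open>U / K\<close> for a left ideal \<open>K\<close> of the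
  enveloping algebra \<open>U\<close>, and two of them are isomorphic if they have the same \<open>K\<close>
  (\<open>presents_iso\<close>).  The universal module is \<open>U / J\<close> where \<open>J\<close> is generated by \<open>P - 1\<close>, \<open>Q\<close> and \<open>Z\<close>
  (\<open>presents_induced_module\<close>), and \<open>L\<close> is \<open>U / (J + U (F - \<xi>))\<close>.  The theorem thus asks for a
  generator of \<open>V\<close> with annihilator \<open>J + U (F - \<xi>)\<close> for some \<open>\<xi>\<close>.

  Two facts about normally ordered polynomials in \<open>E\<close>, \<open>H\<close>, \<open>F\<close> carry the proof.  Modulo \<open>J\<close> they
  exhaust \<open>U\<close> (\<open>normal_form\<close>).  And whenever \<open>\<Sum>i j. E\<^sup>i H\<^sup>j y\<^sub>i\<^sub>j = 0\<close> for quasi-Whittaker vectors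
  \<open>y\<^sub>i\<^sub>j\<close> of some module, all \<open>y\<^sub>i\<^sub>j\<close> vanish (\<open>independent_E\<close>, \<open>independent_H\<close>, \<open>normal_form_unique\<close>),
  because \<open>Q\<close> acts as a derivative with respect to \<open>E\<close> and \<open>P - 1\<close> as a difference operator with respect
  to \<open>H\<close>.
  They show first that \<open>J + U (F - \<xi>)\<close> is a maximal left ideal (\<open>maximal_left_ideal_eq\<close>), so
  it suffices to find a nonzero quasi-Whittaker vector \<open>v'\<close> of \<open>V\<close> with \<open>F v' = \<xi> v'\<close>: by
  simplicity \<open>v'\<close> generates \<open>V\<close>, and its annihilator is proper and contains \<open>J + U (F - \<xi>)\<close>.  Given
  the cyclic quasi-Whittaker vector \<open>v\<close>, either \<open>F v = 0\<close>, or \<open>v = r F v\<close> for some \<open>r\<close> in \<open>U\<close> by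
  simplicity.  Comparing coefficients in the normal form of \<open>r\<close>, the second case yields
  \<open>v = g(F) F v\<close> with a polynomial \<open>g\<close>.  So a nonzero polynomial in \<open>F\<close> kills \<open>v\<close>, and factoring it
  over the complex numbers produces \<open>v'\<close> (\<open>exists_eigenvector\<close>).
\<close>

section \<open>Sums over the support of a polynomial mapping\<close>

lemma poly_mapping_additive_induct:
  fixes t :: "'a \<Rightarrow>\<^sub>0 'b::monoid_add"
  assumes single: "\<And>w c. P (Poly_Mapping.single w c)"
    and add: "\<And>s t. P s \<Longrightarrow> P t \<Longrightarrow> P (s + t)"
  shows "P t"
proof (induction t rule: update_induct)
  case const
  show ?case using single[of _ 0] by simp
next
  case (update f a b)
  have "Poly_Mapping.update a b f = Poly_Mapping.single a b + f"
    using update.hyps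
    by (intro poly_mapping_eqI)
      (auto simp: lookup_update lookup_add lookup_single when_def in_keys_iff)
  then show ?case using add single update by metis
qed

lemma sum_keys_superset:
  fixes t :: "'a \<Rightarrow>\<^sub>0 'b::zero"
  assumes "finite S" "Poly_Mapping.keys t \<subseteq> S" "\<And>k. g k 0 = 0"
  shows "(\<Sum>k\<in>Poly_Mapping.keys t. g k (Poly_Mapping.lookup t k)) =
         (\<Sum>k\<in>S. g k (Poly_Mapping.lookup t k))"
  using assms by (intro sum.mono_neutral_left) (auto simp: in_keys_iff)

lemma sum_keys_add:
  fixes s t :: "'a \<Rightarrow>\<^sub>0 'b::monoid_add" and g :: "'a \<Rightarrow> 'b \<Rightarrow> 'c::comm_monoid_add"
  assumes "\<And>k. g k 0 = 0" "\<And>k a b. g k (a + b) = g k a + g k b"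
  shows "(\<Sum>k\<in>Poly_Mapping.keys (s + t). g k (Poly_Mapping.lookup (s + t) k)) =
     (\<Sum>k\<in>Poly_Mapping.keys s. g k (Poly_Mapping.lookup s k)) +
     (\<Sum>k\<in>Poly_Mapping.keys t. g k (Poly_Mapping.lookup t k))"
proof -
  let ?S = "Poly_Mapping.keys s \<union> Poly_Mapping.keys t"
  have "(\<Sum>k\<in>Poly_Mapping.keys (s + t). g k (Poly_Mapping.lookup (s + t) k)) =
      (\<Sum>k\<in>?S. g k (Poly_Mapping.lookup (s + t) k))"
    by (rule sum_keys_superset) (auto simp: assms keys_add)
  then show ?thesis
    using assms by (simp add: sum_keys_superset[of ?S] lookup_add sum.distrib)
qed

section \<open>Computing in an enveloping algebra\<close>

lemma free_const_hom:
  "free_const (c + d) = free_const c + (free_const d :: 'a free_alg)"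
  "free_const (c * d) = free_const c * (free_const d :: 'a free_alg)"
  "free_const 1 = (1 :: 'a free_alg)"
  "free_const c * (t :: 'a free_alg) = t * free_const c"
     apply (simp add: free_const_def single_add)
    apply (simp add: free_const_def mult_single)
   apply (simp add: free_const_def)
  apply (induction t rule: poly_mapping_additive_induct)
   apply (simp_all add: free_const_def mult_single algebra_simps)
  done

lemma uea_const_add: "uea_const (c + d) = uea_const c + uea_const d"
  by transfer (simp add: free_const_hom(1,2) uea_ideal_zero)

lemma uea_const_mult: "uea_const (c * d) = uea_const c * uea_const d"
  by transfer (simp add: free_const_hom(1,2) uea_ideal_zero)

lemma uea_const_1: "uea_const 1 = 1"
  by transfer (simp add: free_const_hom(3) uea_ideal_zero)

lemma uea_const_0: "uea_const 0 = 0"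
  using uea_const_add[of 0 0] by simp

lemma uea_const_minus: "uea_const (- c) = - uea_const c"
  by (rule minus_unique[symmetric]) (simp add: uea_const_0 flip: uea_const_add)

lemma uea_const_central: "uea_const c * u = u * uea_const c"
  by transfer (simp add: free_const_hom(4) uea_ideal_zero)

lemma uea_ideal_rels: "r \<in> uea_rels \<Longrightarrow> r \<in> uea_ideal"
  using uea_ideal_add[of r 0 1 1] by (simp add: uea_ideal_zero)

lemma uea_gen_add: "uea_gen (x + y) = uea_gen x + uea_gen y"
  by transfer (metis diff_diff_eq uea_rels.intros(1) uea_ideal_rels)

lemma uea_gen_cscale: "uea_gen (c *\<^sub>C x) = uea_const c * uea_gen x"
  by transfer (use uea_rels.intros(2) uea_ideal_rels in blast)

lemma uea_gen_commute: "uea_gen x * uea_gen y = uea_gen y * uea_gen x + uea_gen (bracket x y)"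
  by transfer (metis diff_diff_eq uea_rels.intros(3) uea_ideal_rels)

lemma abs_uea_single:
  "abs_uea (Poly_Mapping.single w c) = uea_const c * prod_list (map uea_gen (letters w))"
proof -
  have 1: "abs_uea (Poly_Mapping.single (Word xs) 1) = prod_list (map uea_gen xs)"
    for xs :: "'a list"
  proof (induction xs)
    case Nil
    show ?case by (simp add: zero_word_def[symmetric] one_uea.abs_eq)
  next
    case (Cons x xs)
    have "Poly_Mapping.single (Word (x # xs)) 1 = free_gen x * Poly_Mapping.single (Word xs) 1"
      by (simp add: free_gen_def mult_single plus_word_def)
    then show ?case
      using Cons by (simp flip: times_uea.abs_eq uea_gen.abs_eq)
  qed
  have "Poly_Mapping.single w c = free_const c * Poly_Mapping.single w 1"
    by (simp add: free_const_def mult_single)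
  then have "abs_uea (Poly_Mapping.single w c) = uea_const c * abs_uea (Poly_Mapping.single w 1)"
    by (simp flip: times_uea.abs_eq uea_const.abs_eq)
  with 1[of "letters w"] show ?thesis by simp
qed

lemma abs_rep_uea: "abs_uea (rep_uea u) = u"
  by (rule Quotient_abs_rep[OF Quotient_uea])

lemma rep_abs_uea: "rep_uea (abs_uea t) - t \<in> uea_ideal"
  using uea.abs_eq_iff abs_rep_uea by blast

lemma abs_uea_induct: "(\<And>t. P (abs_uea t)) \<Longrightarrow> P u"
  by (metis abs_rep_uea)

text \<open>Words in the generators act by repeated left multiplication, so a set closed under the linear
  operations and under left multiplication by generators need only contain \<open>1\<close>.  This is the form
  of induction that suits left ideals and modules.\<close>

lemma uea_induct [case_names one add const gen]:
  assumes one: "P 1" and add: "\<And>u u'. P u \<Longrightarrow> P u' \<Longrightarrow> P (u + u')"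
    and const: "\<And>c u. P u \<Longrightarrow> P (uea_const c * u)"
    and gen: "\<And>x u. P u \<Longrightarrow> P (uea_gen x * u)"
  shows "P u"
proof (rule abs_uea_induct)
  fix t
  show "P (abs_uea t)"
  proof (induction t rule: poly_mapping_additive_induct)
    case (1 w c)
    have "P (prod_list (map uea_gen xs))" for xs
      by (induction xs) (auto intro: one gen)
    then show ?case by (simp add: abs_uea_single const)
  next
    case (2 s t)
    then show ?case by (simp add: add flip: plus_uea.abs_eq)
  qed
qed

section \<open>Functoriality of the enveloping algebra\<close>

lemma free_map_add: "free_map f (s + t) = free_map f s + free_map f t"
  unfolding free_map_def by (rule sum_keys_add) (simp_all add: single_add)

lemma free_map_single: "free_map f (Poly_Mapping.single w c) = Poly_Mapping.single (map_word f w) c"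
  by (cases "c = 0") (simp_all add: free_map_def)

lemma free_map_mult: "free_map f (s * t) = free_map f s * free_map f t"
proof -
  have w: "map_word f (w + w') = map_word f w + map_word f w'" for w w'
    by (cases w; cases w') (simp add: plus_word_def)
  have "free_map f (Poly_Mapping.single w c * t) = free_map f (Poly_Mapping.single w c) * free_map f t"
    for w c
    by (induction t rule: poly_mapping_additive_induct)
      (simp_all add: mult_single free_map_single w distrib_left free_map_add)
  then show ?thesis
    by (induction s rule: poly_mapping_additive_induct) (simp_all add: distrib_right free_map_add)
qed

lemma free_map_0: "free_map f 0 = 0"
  by (simp add: free_map_def)

lemma free_map_diff: "free_map f (s - t) = free_map f s - free_map f t"
  using free_map_add[of f "s - t" t] by simp

lemma free_map_const: "free_map f (free_const c) = free_const c"
  by (simp add: free_const_def free_map_single zero_word_def)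

lemma free_map_gen: "free_map f (free_gen x) = free_gen (f x)"
  by (simp add: free_gen_def free_map_single)

text \<open>With this, \<^const>\<open>uea_map\<close> does not depend on the chosen representative and is a ring
  homomorphism.\<close>

lemma free_map_ideal:
  assumes "lie_hom f" "s \<in> uea_ideal"
  shows "free_map f s \<in> uea_ideal"
  using assms(2)
proof (induction rule: uea_ideal.induct)
  case (uea_ideal_add r s a b)
  from uea_ideal_add(1) have "free_map f r \<in> uea_rels"
    by cases (use assms(1) in \<open>auto simp: lie_hom_def free_map_diff free_map_mult free_map_const
        free_map_gen intro: uea_rels.intros\<close>)
  then show ?case
    using uea_ideal_add by (simp add: free_map_add free_map_mult uea_ideal.uea_ideal_add)
qed (simp add: free_map_0 uea_ideal_zero)

lemma uea_map_abs:
  assumes "lie_hom f"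
  shows "uea_map f (abs_uea t) = abs_uea (free_map f t)"
  using free_map_ideal[OF assms rep_abs_uea[of t]]
  by (simp add: uea_map_def uea.abs_eq_iff free_map_diff)

lemma uea_map_hom:
  assumes "lie_hom f"
  shows "uea_map f (u + u') = uea_map f u + uea_map f u'"
    and "uea_map f (u * u') = uea_map f u * uea_map f u'"
    and "uea_map f (uea_const c) = uea_const c"
    and "uea_map f (uea_gen x) = uea_gen (f x)"
    and "uea_map f 1 = 1"
proof -
  show "uea_map f (u + u') = uea_map f u + uea_map f u'"
    by (induction u rule: abs_uea_induct; induction u' rule: abs_uea_induct)
      (simp add: plus_uea.abs_eq uea_map_abs[OF assms] free_map_add)
  show "uea_map f (u * u') = uea_map f u * uea_map f u'"
    by (induction u rule: abs_uea_induct; induction u' rule: abs_uea_induct)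
      (simp add: times_uea.abs_eq uea_map_abs[OF assms] free_map_mult)
  show c: "uea_map f (uea_const c) = uea_const c" for c
    by (simp add: uea_const.abs_eq uea_map_abs[OF assms] free_map_const)
  show "uea_map f (uea_gen x) = uea_gen (f x)"
    by (simp add: uea_gen.abs_eq uea_map_abs[OF assms] free_map_gen)
  show "uea_map f 1 = 1"
    using c[of 1] by (simp add: uea_const_1)
qed

section \<open>The action of the enveloping algebra on a module\<close>

lemma complex_ring_simps [simp]:
  "carrier complex_ring = UNIV" "c \<oplus>\<^bsub>complex_ring\<^esub> d = c + d" "c \<otimes>\<^bsub>complex_ring\<^esub> d = c * d"
  "\<zero>\<^bsub>complex_ring\<^esub> = 0" "\<one>\<^bsub>complex_ring\<^esub> = 1"
  by (simp_all add: complex_ring_def)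

context lie_module
begin

lemma word_act_closed: "v \<in> carrier V \<Longrightarrow> word_act V w v \<in> carrier V"
proof -
  have "v \<in> carrier V \<Longrightarrow> foldr (act V) xs v \<in> carrier V" for xs
    by (induction xs) (simp_all add: act_closed)
  then show "v \<in> carrier V \<Longrightarrow> word_act V w v \<in> carrier V"
    by (simp add: word_act_def)
qed

lemma word_act_linear:
  assumes "v \<in> carrier V" "v' \<in> carrier V"
  shows "word_act V w (v \<oplus> v') = word_act V w v \<oplus> word_act V w v'"
    and "word_act V w (c \<odot> v) = c \<odot> word_act V w v"
proof -
  have cl: "foldr (act V) xs v \<in> carrier V" "foldr (act V) xs v' \<in> carrier V" for xs
    using word_act_closed[of _ "Word xs"] assms by (simp_all add: word_act_def)
  have "foldr (act V) xs (v \<oplus> v') = foldr (act V) xs v \<oplus> foldr (act V) xs v' \<and>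
    foldr (act V) xs (c \<odot> v) = c \<odot> foldr (act V) xs v" for xs
    by (induction xs) (simp_all add: act_add_right act_smult_right cl)
  then show "word_act V w (v \<oplus> v') = word_act V w v \<oplus> word_act V w v'"
     "word_act V w (c \<odot> v) = c \<odot> word_act V w v"
    by (simp_all add: word_act_def)
qed

lemma smult_zero_left: "v \<in> carrier V \<Longrightarrow> 0 \<odot> v = \<zero>"
  using smult_l_null by simp

lemma free_act_superset:
  assumes "finite S" "Poly_Mapping.keys t \<subseteq> S" "v \<in> carrier V"
  shows "free_act V t v = (\<Oplus>w\<in>S. Poly_Mapping.lookup t w \<odot> word_act V w v)"
  unfolding free_act_def
  by (rule M.add.finprod_mono_neutral_cong_left)
    (use assms in \<open>auto simp: in_keys_iff smult_zero_left word_act_closed\<close>)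

lemma free_act_closed: "v \<in> carrier V \<Longrightarrow> free_act V t v \<in> carrier V"
  unfolding free_act_def by (auto intro!: M.finsum_closed simp: word_act_closed)

lemma free_act_add:
  assumes v: "v \<in> carrier V"
  shows "free_act V (s + t) v = free_act V s v \<oplus> free_act V t v"
proof -
  let ?S = "Poly_Mapping.keys s \<union> Poly_Mapping.keys t"
  have "free_act V (s + t) v = (\<Oplus>w\<in>?S. Poly_Mapping.lookup (s + t) w \<odot> word_act V w v)"
    by (rule free_act_superset) (auto simp: v keys_add)
  also have "\<dots> = (\<Oplus>w\<in>?S. Poly_Mapping.lookup s w \<odot> word_act V w v
                         \<oplus> Poly_Mapping.lookup t w \<odot> word_act V w v)"
    using smult_l_distr by (intro M.finsum_cong') (auto simp: lookup_add word_act_closed v)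
  also have "\<dots> = free_act V s v \<oplus> free_act V t v"
    by (subst M.finsum_addf) (auto simp: free_act_superset[of ?S] word_act_closed v)
  finally show ?thesis .
qed

lemma free_act_single:
  "v \<in> carrier V \<Longrightarrow> free_act V (Poly_Mapping.single w c) v = c \<odot> word_act V w v"
  by (subst free_act_superset[of "{w}"]) (auto simp: word_act_closed)

lemma free_act_zero: "v \<in> carrier V \<Longrightarrow> free_act V 0 v = \<zero>"
  by (simp add: free_act_def)

lemma free_act_diff:
  assumes v: "v \<in> carrier V"
  shows "free_act V (s - t) v = free_act V s v \<ominus> free_act V t v"
proof -
  have "free_act V (s - t) v \<oplus> free_act V t v = free_act V s v"
    using free_act_add[OF v, of "s - t" t] by simp
  then show ?thesis
    using free_act_closed[OF v]
    by (metis M.a_assoc M.r_neg M.r_zero M.a_inv_closed a_minus_def)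
qed

lemma free_act_mult:
  assumes v: "v \<in> carrier V"
  shows "free_act V (s * t) v = free_act V s (free_act V t v)"
proof -
  have w: "word_act V (w + w') v = word_act V w (word_act V w' v)" for w w'
    by (simp add: word_act_def plus_word_def)
  have "free_act V (Poly_Mapping.single w c * t) v =
      free_act V (Poly_Mapping.single w c) (free_act V t v)" for w c
  proof (induction t rule: poly_mapping_additive_induct)
    case (1 w' c')
    show ?case
      using v smult_assoc1 by (simp add: mult_single free_act_single word_act_closed w word_act_linear)
  next
    case (2 s t)
    then show ?case
      using v smult_r_distr
      by (simp add: distrib_left free_act_add free_act_single free_act_closed word_act_closed
          word_act_linear)
  qed
  then show ?thesis
    by (induction s rule: poly_mapping_additive_induct)
      (simp_all add: distrib_right free_act_add free_act_closed v)
qed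

lemma free_act_gen: "v \<in> carrier V \<Longrightarrow> free_act V (free_gen x) v = act V x v"
  by (simp add: free_gen_def free_act_single word_act_def smult_one[simplified] act_closed)

lemma free_act_const: "v \<in> carrier V \<Longrightarrow> free_act V (free_const c) v = c \<odot> v"
  by (simp add: free_const_def free_act_single word_act_def zero_word_def)

lemma act_zero: "act V x \<zero> = \<zero>"
  using act_smult_right[of \<zero> x 0] by (simp add: smult_zero_left act_closed)

lemma free_act_on_zero: "free_act V t \<zero> = \<zero>"
proof (induction t rule: poly_mapping_additive_induct)
  case (1 w c)
  have "foldr (act V) xs \<zero> = \<zero>" for xs
    by (induction xs) (simp_all add: act_zero)
  then show ?case by (simp add: free_act_single word_act_def)
qed (simp add: free_act_add)

lemma free_act_rels:
  assumes "r \<in> uea_rels" and v: "v \<in> carrier V"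
  shows "free_act V r v = \<zero>"
  using assms(1)
proof cases
  case (1 x y)
  have "act V x v \<oplus> act V y v \<ominus> act V x v \<ominus> act V y v = \<zero>"
    using act_closed[OF v, of x] act_closed[OF v, of y] M.r_neg[of "act V x v \<oplus> act V y v"]
    by (simp add: a_minus_def M.minus_add M.a_assoc)
  then show ?thesis
    using 1 v by (simp add: free_act_diff free_act_gen act_add_left)
next
  case (2 c x)
  then show ?thesis
    using v act_closed[OF v, of x]
    by (simp add: free_act_diff free_act_gen act_cscale_left free_act_mult free_act_const
        act_closed a_minus_def M.r_neg)
next
  case (3 x y)
  then show ?thesis
    using v by (simp add: free_act_diff free_act_gen act_bracket free_act_mult
        act_closed a_minus_def M.r_neg)
qed

text \<open>Hence \<^const>\<open>uea_act\<close> does not depend on the chosen representative.\<close>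

lemma free_act_ideal:
  assumes "s \<in> uea_ideal" and v: "v \<in> carrier V"
  shows "free_act V s v = \<zero>"
  using assms(1)
  by (induction rule: uea_ideal.induct)
    (simp_all add: v free_act_zero free_act_add free_act_mult free_act_closed free_act_rels
      free_act_on_zero)

lemma uea_act_abs:
  assumes v: "v \<in> carrier V"
  shows "uea_act V (abs_uea t) v = free_act V t v"
  using free_act_ideal[OF rep_abs_uea[of t] v] v
    free_act_add[OF v, of "rep_uea (abs_uea t) - t" t]
  by (simp add: uea_act_def free_act_closed)

lemma uea_act_closed: "v \<in> carrier V \<Longrightarrow> uea_act V u v \<in> carrier V"
  by (simp add: uea_act_def free_act_closed)

lemma uea_act_hom:
  assumes v: "v \<in> carrier V"
  shows "uea_act V (u + u') v = uea_act V u v \<oplus> uea_act V u' v"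
    and "uea_act V (u * u') v = uea_act V u (uea_act V u' v)"
    and "uea_act V (uea_const c) v = c \<odot> v"
    and "uea_act V (uea_gen x) v = act V x v"
    and "uea_act V 1 v = v"
    and "uea_act V 0 v = \<zero>"
proof -
  show "uea_act V (u + u') v = uea_act V u v \<oplus> uea_act V u' v"
    by (induction u rule: abs_uea_induct; induction u' rule: abs_uea_induct)
      (simp add: plus_uea.abs_eq uea_act_abs[OF v] free_act_add[OF v])
  show "uea_act V (u * u') v = uea_act V u (uea_act V u' v)"
    by (induction u rule: abs_uea_induct; induction u' rule: abs_uea_induct)
      (simp add: times_uea.abs_eq uea_act_abs v free_act_mult free_act_closed)
  show c: "uea_act V (uea_const c) v = c \<odot> v" for c
    by (simp add: uea_const.abs_eq uea_act_abs[OF v] free_act_const v)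
  show "uea_act V (uea_gen x) v = act V x v"
    by (simp add: uea_gen.abs_eq uea_act_abs[OF v] free_act_gen v)
  show "uea_act V 1 v = v"
    using c[of 1] smult_one v by (simp add: uea_const_1)
  show "uea_act V 0 v = \<zero>"
    using c[of 0] v by (simp add: uea_const_0 smult_zero_left)
qed

end

lemma uea_const_of_nat: "uea_const (of_nat n) = of_nat n"
  by (induction n) (simp_all add: uea_const_0 uea_const_add uea_const_1)

lemma of_nat_left_commute: "u * (of_nat k * x) = of_nat k * (u * x)" for u x :: "'r::ring_1"
proof -
  have "u * (of_nat k * x) = u * of_nat k * x" by (rule mult.assoc[symmetric])
  also have "\<dots> = of_nat k * u * x" by (simp only: mult_of_nat_commute)
  finally show ?thesis by (simp only: mult.assoc)
qed

section \<open>Left ideals\<close>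

definition left_ideal :: "'r::ring_1 set \<Rightarrow> bool" where
  "left_ideal A \<longleftrightarrow> 0 \<in> A \<and> (\<forall>x\<in>A. \<forall>y\<in>A. x + y \<in> A) \<and> (\<forall>r. \<forall>x\<in>A. r * x \<in> A)"

lemma left_ideal_zero: "left_ideal A \<Longrightarrow> 0 \<in> A"
  and left_ideal_add: "left_ideal A \<Longrightarrow> x \<in> A \<Longrightarrow> y \<in> A \<Longrightarrow> x + y \<in> A"
  and left_ideal_mult: "left_ideal A \<Longrightarrow> x \<in> A \<Longrightarrow> r * x \<in> A"
  by (simp_all add: left_ideal_def)

lemma left_ideal_uminus: "left_ideal A \<Longrightarrow> x \<in> A \<Longrightarrow> - x \<in> A"
  using left_ideal_mult[of A x "- 1"] by simp

lemma left_ideal_diff: "left_ideal A \<Longrightarrow> x \<in> A \<Longrightarrow> y \<in> A \<Longrightarrow> x - y \<in> A"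
  using left_ideal_add[of A x "- y"] left_ideal_uminus[of A y] by simp

lemma left_ideal_sum: "left_ideal A \<Longrightarrow> (\<And>i. i \<in> S \<Longrightarrow> g i \<in> A) \<Longrightarrow> sum g S \<in> A"
  by (induction S rule: infinite_finite_induct) (simp_all add: left_ideal_zero left_ideal_add)

lemma left_ideal_cong: "left_ideal A \<Longrightarrow> x - y \<in> A \<Longrightarrow> x \<in> A \<longleftrightarrow> y \<in> A"
  using left_ideal_add[of A "x - y" y] left_ideal_diff[of A x "x - y"] by auto

lemma left_ideal_const_cancel:
  assumes "left_ideal A" "c \<noteq> 0" "uea_const c * x \<in> A"
  shows "x \<in> A"
  using left_ideal_mult[OF assms(1,3), of "uea_const (1 / c)"] assms(2)
  by (simp add: mult.assoc[symmetric] uea_const_1 flip: uea_const_mult)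

text \<open>For a left ideal \<open>J\<close> this is the sum of \<open>J\<close> and the principal left ideal of \<open>y\<close>.\<close>

lemma left_ideal_adjoin:
  assumes J: "left_ideal J"
  shows "left_ideal {u. \<exists>r. u - r * y \<in> J}" (is "left_ideal ?B")
  unfolding left_ideal_def
proof (intro conjI ballI allI)
  show "0 \<in> ?B" using left_ideal_zero[OF J] by (auto intro!: exI[of _ 0])
next
  fix x x' assume "x \<in> ?B" "x' \<in> ?B"
  then obtain r s where "x - r * y \<in> J" "x' - s * y \<in> J" by auto
  then have "(x - r * y) + (x' - s * y) \<in> J" by (rule left_ideal_add[OF J])
  then show "x + x' \<in> ?B" by (auto simp: algebra_simps intro!: exI[of _ "r + s"])
next
  fix t x assume "x \<in> ?B"
  then obtain r where "x - r * y \<in> J" by auto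
  then have "t * (x - r * y) \<in> J" by (rule left_ideal_mult[OF J])
  then show "t * x \<in> ?B" by (auto simp: algebra_simps intro!: exI[of _ "t * r"])
qed

section \<open>Normally ordered polynomials\<close>

text \<open>The polynomial with its variable replaced by \<open>X\<close> and its coefficients by their images under
  \<open>ev\<close>, powers of \<open>X\<close> standing on the left.  Ring elements need not commute, so nested use of this
  map on polynomials with polynomial coefficients yields normally ordered expressions.\<close>

definition poly_sum :: "'r::ring_1 \<Rightarrow> ('b::zero \<Rightarrow> 'r) \<Rightarrow> 'b poly \<Rightarrow> 'r" where
  "poly_sum X ev g = (\<Sum>i\<le>degree g. X ^ i * ev (coeff g i))"

lemma poly_sum_superset:
  assumes "ev 0 = 0" "degree g \<le> n"
  shows "poly_sum X ev g = (\<Sum>i\<le>n. X ^ i * ev (coeff g i))"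
  unfolding poly_sum_def
  by (rule sum.mono_neutral_left) (use assms in \<open>auto simp: coeff_eq_0\<close>)

lemma poly_sum_0: "ev 0 = 0 \<Longrightarrow> poly_sum X ev 0 = 0"
  by (simp add: poly_sum_def)

lemma poly_sum_add:
  assumes "ev 0 = 0" "\<And>a b. ev (a + b) = ev a + ev b"
  shows "poly_sum X ev (g + g') = poly_sum X ev g + poly_sum X ev g'"
  using poly_sum_superset[where n = "max (degree g) (degree g')" and ev = ev and X = X] assms
  by (simp add: degree_add_le distrib_left sum.distrib)

lemma poly_sum_pCons:
  assumes "ev 0 = 0"
  shows "poly_sum X ev (pCons a g) = ev a + X * poly_sum X ev g"
proof -
  have "poly_sum X ev (pCons a g) = (\<Sum>i\<le>Suc (degree g). X ^ i * ev (coeff (pCons a g) i))"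
    by (rule poly_sum_superset) (use assms in \<open>auto simp: degree_pCons_le\<close>)
  also have "\<dots> = ev a + X * poly_sum X ev g"
    unfolding sum.atMost_Suc_shift by (simp add: poly_sum_def sum_distrib_left mult.assoc)
  finally show ?thesis .
qed

lemma poly_sum_map_poly:
  assumes "ev 0 = 0" "\<phi> 0 = 0" "\<And>a. ev (\<phi> a) = ev a * r"
  shows "poly_sum X ev (map_poly \<phi> g) = poly_sum X ev g * r"
proof -
  have "poly_sum X ev (map_poly \<phi> g) = (\<Sum>i\<le>degree g. X ^ i * ev (coeff (map_poly \<phi> g) i))"
    by (rule poly_sum_superset) (use assms in \<open>auto intro!: degree_le simp: coeff_map_poly coeff_eq_0\<close>)
  then show ?thesis
    by (simp add: poly_sum_def coeff_map_poly assms sum_distrib_right mult.assoc)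
qed

section \<open>Left ideals of Whittaker type for a Schroedinger basis\<close>

text \<open>The relations are those of the standard basis.  Stating them for arbitrary elements makes the
  results available for every basis obtained from the standard one by an automorphism; such a
  change of basis replaces an arbitrary nonzero \<open>\<phi>\<close> by one with \<open>\<phi> p = 1\<close> and \<open>\<phi> q = 0\<close>.\<close>

locale schroedinger_basis =
  fixes e h f p q z :: "'l::complex_lie_algebra"
  assumes brackets:
      "bracket h e = 2 *\<^sub>C e" "bracket h f = (- 2) *\<^sub>C f" "bracket e f = h"
      "bracket h p = p" "bracket h q = - q" "bracket p q = z" "bracket e q = p"
      "bracket p f = - q" "bracket f q = 0" "bracket e p = 0" "\<And>x. bracket z x = 0"
    and spanning: "\<exists>a b c s t r. x = a *\<^sub>C e + b *\<^sub>C h + c *\<^sub>C f + s *\<^sub>C p + t *\<^sub>C q + r *\<^sub>C z"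
begin

abbreviation "E \<equiv> uea_gen e"
abbreviation "H \<equiv> uea_gen h"
abbreviation "F \<equiv> uea_gen f"
abbreviation "P \<equiv> uea_gen p"
abbreviation "Q \<equiv> uea_gen q"
abbreviation "Z \<equiv> uea_gen z"

lemma uea_gen_uminus: "uea_gen (- x) = - uea_gen x"
  and uea_gen_0: "uea_gen 0 = 0"
proof -
  show 0: "uea_gen 0 = 0" using uea_gen_add[of 0 0] by simp
  show "uea_gen (- x) = - uea_gen x"
    by (rule minus_unique[symmetric]) (simp add: 0 flip: uea_gen_add)
qed

lemma commutation:
  "H * E = E * H + 2 * E"
  "P * F = F * P - Q" "Q * F = F * Q" "Z * uea_gen x = uea_gen x * Z"
  "P * H = H * P - P" "Q * H = H * Q + Q"
  "P * E = E * P" "Q * E = E * Q - P" "P * Q = Q * P + Z"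
proof -
  have 2: "uea_const 2 = 2"
    using uea_const_of_nat[of 2] by simp
  show "H * E = E * H + 2 * E"
    using uea_gen_commute[of h e] by (simp add: brackets uea_gen_cscale 2)
  show "P * F = F * P - Q"
    using uea_gen_commute[of p f] by (simp add: brackets uea_gen_uminus)
  show "Q * F = F * Q"
    using uea_gen_commute[of f q] by (simp add: brackets uea_gen_0)
  show "Z * uea_gen x = uea_gen x * Z"
    using uea_gen_commute[of z x] by (simp add: brackets uea_gen_0)
  show "P * H = H * P - P"
    using uea_gen_commute[of h p] by (simp add: brackets algebra_simps)
  show "Q * H = H * Q + Q"
    using uea_gen_commute[of h q] by (simp add: brackets uea_gen_uminus algebra_simps)
  show "P * E = E * P"
    using uea_gen_commute[of e p] by (simp add: brackets uea_gen_0)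
  show "Q * E = E * Q - P"
    using uea_gen_commute[of e q] by (simp add: brackets algebra_simps)
  show "P * Q = Q * P + Z"
    using uea_gen_commute[of p q] by (simp add: brackets)
qed

text \<open>The class of \<open>y\<close> in the quotient by \<open>A\<close> is zero or a quasi-Whittaker vector of the type with
  \<open>p \<mapsto> 1\<close>, \<open>q \<mapsto> 0\<close>, \<open>z \<mapsto> 0\<close>.\<close>

definition whittaker_mod :: "'l uea set \<Rightarrow> 'l uea \<Rightarrow> bool" where
  "whittaker_mod A y \<longleftrightarrow> (P - 1) * y \<in> A \<and> Q * y \<in> A \<and> Z * y \<in> A"

text \<open>Since \<open>[p, f] = - q\<close> kills such vectors and \<open>[q, f] = 0\<close>, the operator \<open>f\<close> acts on the space of
  quasi-Whittaker vectors.\<close>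

lemma whittaker_mod_F:
  assumes A: "left_ideal A" and y: "whittaker_mod A y"
  shows "whittaker_mod A (F * y)"
proof -
  have "(P - 1) * (F * y) = F * ((P - 1) * y) - Q * y"
    by (simp add: algebra_simps commutation(2) flip: mult.assoc)
  moreover have "Q * (F * y) = F * (Q * y)" "Z * (F * y) = F * (Z * y)"
    by (simp_all add: commutation(3,4) flip: mult.assoc)
  ultimately show ?thesis
    using y A by (simp add: whittaker_mod_def left_ideal_diff left_ideal_mult)
qed

lemma whittaker_mod_const:
  assumes A: "left_ideal A" and y: "whittaker_mod A y"
  shows "whittaker_mod A (uea_const c * y)"
proof -
  have "u * (uea_const c * y) = uea_const c * (u * y)" for u
    by (metis mult.assoc uea_const_central)
  then show ?thesis
    using y A by (simp add: whittaker_mod_def left_ideal_mult)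
qed

lemma whittaker_mod_add:
  "left_ideal A \<Longrightarrow> whittaker_mod A y \<Longrightarrow> whittaker_mod A y' \<Longrightarrow> whittaker_mod A (y + y')"
  by (simp add: whittaker_mod_def distrib_left left_ideal_add)

text \<open>Polynomials in \<open>f\<close>, in \<open>h\<close> and \<open>f\<close>, and in \<open>e\<close>, \<open>h\<close> and \<open>f\<close>, ordered as
  \<open>e\<^sup>i h\<^sup>j f\<^sup>k\<close>.\<close>

abbreviation "evF \<equiv> poly_sum F uea_const"
abbreviation "evH \<equiv> poly_sum H evF"
abbreviation "evE \<equiv> poly_sum E evH"

lemma ev_simps [simp]:
  "uea_const 0 = 0" "evF 0 = 0" "evH 0 = 0" "evE 0 = 0"
  "evF (pCons c g) = uea_const c + F * evF g"
  "evH (pCons g k) = evF g + H * evH k"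
  "evE (pCons k G) = evH k + E * evE G"
  "evF (g + g') = evF g + evF g'"
  "evH (k + k') = evH k + evH k'"
  "evE (G + G') = evE G + evE G'"
  by (simp_all add: poly_sum_0 poly_sum_pCons poly_sum_add uea_const_0 uea_const_add)

lemma evF_smult: "evF (smult c g) = uea_const c * evF g"
proof (induction g)
  case (pCons a g)
  then show ?case
    by (simp add: distrib_left uea_const_mult)
      (metis mult.assoc uea_const_central)
qed simp

lemma evF_commute: "evF g * F = F * evF g"
  by (induction g) (simp_all add: algebra_simps uea_const_central)

lemma whittaker_mod_evF:
  assumes A: "left_ideal A" and y: "whittaker_mod A y"
  shows "whittaker_mod A (evF g * y)"
proof (induction g)
  case 0
  then show ?case using A by (simp add: whittaker_mod_def left_ideal_zero)
next
  case (pCons c g)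
  have "evF (pCons c g) * y = uea_const c * y + F * (evF g * y)"
    by (simp add: distrib_right mult.assoc)
  then show ?case
    using pCons(2) A y by (metis whittaker_mod_add whittaker_mod_const whittaker_mod_F)
qed

text \<open>Modulo \<open>J\<close> the ordered monomials \<open>e\<^sup>i h\<^sup>j f\<^sup>k\<close> span.  The span contains \<open>1\<close>, so it has to be shown
  stable under every generator \<open>x\<close>.  Moving \<open>x\<close> past a leading \<open>e\<close> costs only the term
  with \<open>[x, e]\<close> in place of \<open>x\<close> on a shorter monomial, so induction on the monomial for all \<open>x\<close>
  simultaneously avoids explicit commutation formulas; the same works for \<open>h\<close>, once the span is
  known to be stable under \<open>h\<close>.  On a polynomial in \<open>f\<close> alone, \<open>p\<close>, \<open>q\<close> and \<open>z\<close> act by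
  scalars because \<open>f\<close> preserves quasi-Whittaker vectors.\<close>

lemma normal_form:
  assumes J: "left_ideal J" and gens: "P - 1 \<in> J" "Q \<in> J" "Z \<in> J"
  shows "\<exists>G. u - evE G \<in> J"
proof -
  define B where "B = {u. \<exists>G. u - evE G \<in> J}"
  have ev: "evE G \<in> B" for G
    using J by (auto simp: B_def intro!: exI[of _ G] left_ideal_zero)
  have J_B: "u \<in> B" if "u \<in> J" for u
    using that by (auto simp: B_def intro!: exI[of _ 0])
  have add: "u + u' \<in> B" if "u \<in> B" "u' \<in> B" for u u'
  proof -
    from that obtain G G' where "u - evE G \<in> J" "u' - evE G' \<in> J"
      by (auto simp: B_def)
    then have "(u - evE G) + (u' - evE G') \<in> J"
      by (rule left_ideal_add[OF J])
    then show ?thesis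
      by (auto simp: B_def algebra_simps intro!: exI[of _ "G + G'"])
  qed
  have cong: "u \<in> B" if "u - u' \<in> J" "u' \<in> B" for u u'
    using add[OF J_B[OF that(1)] that(2)] by simp
  have const: "uea_const c * u \<in> B" if "u \<in> B" for c u
  proof -
    from that obtain G where "u - evE G \<in> J" by (auto simp: B_def)
    then have "uea_const c * (u - evE G) \<in> J" by (rule left_ideal_mult[OF J])
    moreover have "evE (map_poly (map_poly (smult c)) G) = evE G * uea_const c"
      by (intro poly_sum_map_poly) (simp_all add: evF_smult uea_const_central)
    ultimately show ?thesis
      by (auto simp: B_def right_diff_distrib uea_const_central
          intro!: exI[of _ "map_poly (map_poly (smult c)) G"])
  qed
  have E: "E * u \<in> B" if "u \<in> B" for u
  proof -
    from that obtain G where "u - evE G \<in> J" by (auto simp: B_def)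
    then have "E * (u - evE G) \<in> J" by (rule left_ideal_mult[OF J])
    then show ?thesis
      by (auto simp: B_def right_diff_distrib intro!: exI[of _ "pCons 0 G"])
  qed
  have H_ev: "H * evE G \<in> B" for G
  proof (induction G)
    case 0
    then show ?case using ev[of 0] by simp
  next
    case (pCons k G)
    have "H * evE (pCons k G) = H * evH k + (H * E) * evE G"
      by (simp add: distrib_left mult.assoc)
    also have "\<dots> = evE [:pCons 0 k:] + E * (H * evE G) + (E * evE G + E * evE G)"
      unfolding commutation(1) by (simp add: algebra_simps mult_2)
    also have "\<dots> \<in> B"
      by (intro add E ev pCons)
    finally show ?case .
  qed
  have H: "H * u \<in> B" if "u \<in> B" for u
  proof -
    from that obtain G where "u - evE G \<in> J" by (auto simp: B_def)
    then have "H * (u - evE G) \<in> J" by (rule left_ideal_mult[OF J])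
    then show ?thesis
      using H_ev[of G] by (auto simp: right_diff_distrib intro: cong)
  qed
  have F_ev: "uea_gen x * evF g \<in> B" for x g
  proof -
    have "whittaker_mod J (evF g)"
      using whittaker_mod_evF[OF J, of 1 g] gens by (simp add: whittaker_mod_def)
    then have 1: "P * evF g - evF g \<in> J" "Q * evF g \<in> J" "Z * evF g \<in> J"
      by (simp_all add: whittaker_mod_def left_diff_distrib)
    have g: "evF g \<in> B" using ev[of "[:[:g:]:]"] by simp
    have 2: "E * evF g \<in> B" "H * evF g \<in> B" "P * evF g \<in> B" "Q * evF g \<in> B" "Z * evF g \<in> B"
      using E H g 1 J_B cong by blast+
    have 3: "F * evF g \<in> B" using ev[of "[:[:pCons 0 g:]:]"] by simp
    obtain a b c s t r where
      x: "x = a *\<^sub>C e + b *\<^sub>C h + c *\<^sub>C f + s *\<^sub>C p + t *\<^sub>C q + r *\<^sub>C z"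
      using spanning by blast
    show ?thesis
      unfolding x uea_gen_add uea_gen_cscale distrib_right mult.assoc
      by (intro add const 2 3)
  qed
  have comm: "uea_gen x * (uea_gen y * u) = uea_gen y * (uea_gen x * u) + uea_gen (bracket x y) * u"
    for x y u
    by (simp add: distrib_right uea_gen_commute[of x y] flip: mult.assoc)
  have "\<forall>x. uea_gen x * evH k \<in> B" for k
  proof (induction k)
    case 0
    then show ?case using ev[of 0] by simp
  next
    case (pCons g k)
    then show ?case by (auto simp: distrib_left comm[of _ h] intro!: add F_ev H)
  qed
  then have "\<forall>x. uea_gen x * evE G \<in> B" for G
  proof (induction G)
    case 0
    then show ?case using ev[of 0] by simp
  next
    case (pCons g k)
    then show ?case by (auto simp: distrib_left comm[of _ e] intro!: add E)
  qed
  then have gen: "uea_gen x * u \<in> B" if "u \<in> B" for x u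
  proof -
    from that obtain G where "u - evE G \<in> J" by (auto simp: B_def)
    then have "uea_gen x * (u - evE G) \<in> J" by (rule left_ideal_mult[OF J])
    then show ?thesis
      using \<open>\<And>G. \<forall>x. uea_gen x * evE G \<in> B\<close> by (auto simp: right_diff_distrib intro: cong)
  qed
  have "u \<in> B"
    by (induction u rule: uea_induct) (use ev[of 1] in \<open>auto simp: one_pCons uea_const_1 intro: add const gen\<close>)
  then show ?thesis by (simp add: B_def)
qed

section \<open>Uniqueness of normal forms\<close>

text \<open>On a quasi-Whittaker vector \<open>p\<close> acts as \<open>1\<close>, and \<open>p h = (h - 1) p\<close>.  So \<open>p - 1\<close> acts on polynomials
  in \<open>h\<close> as a difference operator, and this is the commutation rule for its powers.\<close>

lemma PH_power:
  "(P - 1) ^ Suc n * H = (H - of_nat (Suc n)) * (P - 1) ^ Suc n - of_nat (Suc n) * (P - 1) ^ n"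
proof (induction n)
  case 0
  show ?case using commutation(5) by (simp add: algebra_simps)
next
  case (Suc n)
  let ?T = "P - 1"
  have TH: "?T * H = (H - 1) * ?T - 1"
    using commutation(5) by (simp add: algebra_simps)
  have com: "x * of_nat k = of_nat k * x" for x :: "'l uea" and k
    by (simp add: mult_of_nat_commute)
  have "?T ^ Suc (Suc n) * H = ?T * (?T ^ Suc n * H)"
    by (simp add: mult.assoc)
  also have "\<dots> = ?T * H * ?T ^ Suc n - of_nat (Suc n) * (?T * ?T ^ Suc n)
      - of_nat (Suc n) * (?T * ?T ^ n)"
    unfolding Suc by (simp only: right_diff_distrib left_diff_distrib mult.assoc[symmetric] com)
  also have "\<dots> = (H - of_nat (Suc (Suc n))) * ?T ^ Suc (Suc n) - of_nat (Suc (Suc n)) * ?T ^ Suc n"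
    unfolding TH by (simp add: algebra_simps)
  finally show ?case .
qed

text \<open>As for finite differences, the \<open>n\<close>-th power of \<open>p - 1\<close> kills \<open>h\<^sup>j y\<close> for \<open>j < n\<close> and sends
  \<open>h\<^sup>n y\<close> to a nonzero multiple of \<open>y\<close>.\<close>

lemma leading_term_H:
  assumes A: "left_ideal A" and y: "whittaker_mod A y"
  shows "(\<forall>j<n. (P - 1) ^ n * (H ^ j * y) \<in> A) \<and>
    (P - 1) ^ n * (H ^ n * y) - uea_const ((- 1) ^ n * fact n) * y \<in> A"
proof (induction n)
  case 0
  show ?case using A by (simp add: uea_const_1 left_ideal_zero)
next
  case (Suc n)
  let ?T = "P - 1" and ?c = "(- 1) ^ n * fact n :: complex"
  have Ty: "?T * y \<in> A" using y by (simp add: whittaker_mod_def)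
  have T_Suc: "?T ^ Suc n * (H ^ j * y) \<in> A" if "j \<le> n" for j
  proof (cases "j = n")
    case False
    then show ?thesis
      using Suc that left_ideal_mult[OF A, of "?T ^ n * (H ^ j * y)" ?T] by (simp add: mult.assoc)
  next
    case True
    have "?T * (?T ^ n * (H ^ n * y) - uea_const ?c * y) + uea_const ?c * (?T * y) \<in> A"
      using Suc Ty by (blast intro: left_ideal_add[OF A] left_ideal_mult[OF A])
    moreover have "?T * (uea_const ?c * y) = uea_const ?c * (?T * y)"
      by (metis mult.assoc uea_const_central)
    ultimately show ?thesis
      by (simp only: True right_diff_distrib power_Suc mult.assoc diff_add_cancel)
  qed
  have step: "?T ^ Suc n * (H ^ Suc j * y) =
      (H - of_nat (Suc n)) * (?T ^ Suc n * (H ^ j * y)) - of_nat (Suc n) * (?T ^ n * (H ^ j * y))" for j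
  proof -
    have "?T ^ Suc n * (H ^ Suc j * y) = ?T ^ Suc n * H * (H ^ j * y)"
      by (simp add: mult.assoc)
    then show ?thesis
      unfolding PH_power by (simp only: left_diff_distrib mult.assoc)
  qed
  have "?T ^ Suc n * (H ^ j * y) \<in> A" if "j < Suc n" for j
    using T_Suc that by simp
  moreover have "?T ^ Suc n * (H ^ Suc n * y) - uea_const ((- 1) ^ Suc n * fact (Suc n)) * y \<in> A"
  proof -
    have 1: "(- 1) ^ Suc n * fact (Suc n) = - (of_nat (Suc n) * ?c)"
      by (simp add: algebra_simps)
    have 2: "uea_const ((- 1) ^ Suc n * fact (Suc n)) = - (of_nat (Suc n) * uea_const ?c)"
      by (simp only: 1 uea_const_minus uea_const_mult uea_const_of_nat)
    have "?T ^ Suc n * (H ^ Suc n * y) - uea_const ((- 1) ^ Suc n * fact (Suc n)) * y =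
      (H - of_nat (Suc n)) * (?T ^ Suc n * (H ^ n * y))
        - of_nat (Suc n) * (?T ^ n * (H ^ n * y) - uea_const ?c * y)"
      unfolding step 2
      by (simp add: right_diff_distrib mult.assoc del: of_nat_Suc fact_Suc power_Suc)
    also have "\<dots> \<in> A"
      using T_Suc[of n] Suc by (blast intro: left_ideal_diff[OF A] left_ideal_mult[OF A])
    finally show ?thesis .
  qed
  ultimately show ?case by blast
qed

text \<open>Powers of \<open>p - 1\<close> isolate the leading coefficient, which may be any quasi-Whittaker vector and
  not only a scalar multiple of a fixed one.\<close>

lemma independent_H:
  assumes A: "left_ideal A" and y: "\<And>j. whittaker_mod A (y j)"
    and "(\<Sum>j\<le>n. H ^ j * y j) \<in> A" "j \<le> n"
  shows "y j \<in> A"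
  using assms(3,4)
proof (induction n arbitrary: j)
  case 0
  then show ?case by simp
next
  case (Suc n)
  let ?T = "P - 1"
  define c :: complex where "c = (- 1) ^ Suc n * fact (Suc n)"
  \<comment> \<open>All terms but the leading one vanish.\<close>
  have lower: "(\<Sum>j\<le>n. ?T ^ Suc n * (H ^ j * y j)) \<in> A"
    using leading_term_H[OF A y, where n = "Suc n"] by (intro left_ideal_sum A) (simp del: power_Suc)
  have "?T ^ Suc n * (\<Sum>j\<le>Suc n. H ^ j * y j) \<in> A"
    by (intro left_ideal_mult A Suc.prems)
  then have "(\<Sum>j\<le>n. ?T ^ Suc n * (H ^ j * y j)) + ?T ^ Suc n * (H ^ Suc n * y (Suc n)) \<in> A"
    by (simp only: sum.atMost_Suc distrib_left sum_distrib_left)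
  from left_ideal_diff[OF A this lower] have "?T ^ Suc n * (H ^ Suc n * y (Suc n)) \<in> A"
    by simp
  with leading_term_H[OF A y, of "Suc n" "Suc n"] have "uea_const c * y (Suc n) \<in> A"
    unfolding c_def using left_ideal_cong[OF A] by blast
  then have top: "y (Suc n) \<in> A"
    by (rule left_ideal_const_cancel[OF A, rotated]) (simp add: c_def del: of_nat_Suc fact_Suc)
  have "(\<Sum>j\<le>Suc n. H ^ j * y j) - H ^ Suc n * y (Suc n) \<in> A"
    by (intro left_ideal_diff left_ideal_mult A Suc.prems top)
  then have "(\<Sum>j\<le>n. H ^ j * y j) \<in> A"
    by simp
  with Suc.IH top Suc.prems(2) show ?case
    by (cases "j = Suc n") auto
qed

text \<open>The coefficients of powers of \<open>e\<close> that occur are of the form \<open>\<Sum>j. h\<^sup>j y\<^sub>j\<close> with quasi-Whittaker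
  vectors \<open>y\<^sub>j\<close>.  All that is used of them is that \<open>q\<close> and \<open>z\<close> kill them and that \<open>p\<close> is
  unipotent, hence injective, on them.\<close>

definition unipotent_mod :: "'l uea set \<Rightarrow> 'l uea \<Rightarrow> bool" where
  "unipotent_mod A y \<longleftrightarrow> (\<exists>n. (P - 1) ^ n * y \<in> A) \<and> Q * y \<in> A \<and> Z * y \<in> A"

lemma power_mult_in:
  assumes A: "left_ideal A" and "r ^ n * y \<in> A" "n \<le> m"
  shows "r ^ m * y \<in> A"
  using left_ideal_mult[OF A assms(2), of "r ^ (m - n)"] assms(3)
  by (simp add: power_add[symmetric] flip: mult.assoc)

lemma unipotent_mod_add:
  assumes A: "left_ideal A" and "unipotent_mod A y" "unipotent_mod A y'"
  shows "unipotent_mod A (y + y')"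
proof -
  from assms obtain n n' where "(P - 1) ^ n * y \<in> A" "(P - 1) ^ n' * y' \<in> A"
    by (auto simp: unipotent_mod_def)
  then have "(P - 1) ^ max n n' * y + (P - 1) ^ max n n' * y' \<in> A"
    by (intro left_ideal_add A; elim power_mult_in[OF A]) auto
  then have "\<exists>n. (P - 1) ^ n * (y + y') \<in> A"
    by (auto simp: distrib_left)
  then show ?thesis
    using assms by (auto simp: unipotent_mod_def distrib_left intro: left_ideal_add)
qed

lemma unipotent_mod_H:
  assumes A: "left_ideal A" and y: "unipotent_mod A y"
  shows "unipotent_mod A (H * y)"
proof -
  from y obtain n where n: "(P - 1) ^ n * y \<in> A"
    by (auto simp: unipotent_mod_def)
  have "(P - 1) ^ Suc n * (H * y) =
      (H - of_nat (Suc n)) * ((P - 1) ^ Suc n * y) - of_nat (Suc n) * ((P - 1) ^ n * y)"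
    unfolding mult.assoc[symmetric] PH_power left_diff_distrib ..
  also have "\<dots> \<in> A"
    by (intro left_ideal_diff left_ideal_mult A n power_mult_in[OF A n]) simp
  finally have "\<exists>n. (P - 1) ^ n * (H * y) \<in> A" ..
  moreover have "Q * (H * y) = H * (Q * y) + Q * y"
    by (simp add: commutation(6) distrib_right flip: mult.assoc)
  moreover have "Z * (H * y) = H * (Z * y)"
    by (simp add: commutation(4) flip: mult.assoc)
  ultimately show ?thesis
    using y A by (simp add: unipotent_mod_def left_ideal_add left_ideal_mult)
qed

lemma unipotent_mod_P:
  assumes A: "left_ideal A" and y: "unipotent_mod A y"
  shows "unipotent_mod A (of_nat k * (P * y))"
proof -
  from y obtain n where n: "(P - 1) ^ n * y \<in> A"
    by (auto simp: unipotent_mod_def)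
  have "(P - 1) ^ n * P = P * (P - 1) ^ n"
    by (rule power_commuting_commutes) (simp add: algebra_simps)
  then have "(P - 1) ^ n * (P * y) = P * ((P - 1) ^ n * y)"
    by (simp only: mult.assoc[symmetric])
  then have "(P - 1) ^ n * (of_nat k * (P * y)) = of_nat k * (P * ((P - 1) ^ n * y))"
    by (simp only: of_nat_left_commute)
  also have "\<dots> \<in> A" by (intro left_ideal_mult A n)
  finally have "\<exists>n. (P - 1) ^ n * (of_nat k * (P * y)) \<in> A" ..
  moreover have "Q * (P * y) = P * (Q * y) - Z * y"
    by (simp add: commutation(9) distrib_right flip: mult.assoc)
  moreover have "Z * (P * y) = P * (Z * y)"
    by (simp add: commutation(4) flip: mult.assoc)
  ultimately show ?thesis
    using y A by (simp add: unipotent_mod_def left_ideal_diff left_ideal_mult of_nat_left_commute)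
qed

text \<open>A vector \<open>y\<close> killed by \<open>p\<close> satisfies \<open>y = - (p - 1) y\<close>, so it vanishes where \<open>p - 1\<close> is
  nilpotent.\<close>

lemma unipotent_mod_P_cancel:
  assumes A: "left_ideal A"
  shows "(P - 1) ^ n * y \<in> A \<Longrightarrow> P * y \<in> A \<Longrightarrow> y \<in> A"
proof (induction n arbitrary: y)
  case (Suc n)
  have "P * ((P - 1) * y) = (P - 1) * (P * y)"
    by (simp add: algebra_simps)
  then have 1: "P * ((P - 1) * y) \<in> A"
    using Suc.prems by (simp add: left_ideal_mult A)
  have "(P - 1) ^ n * ((P - 1) * y) \<in> A"
    using Suc.prems(1) by (simp only: power_Suc2 mult.assoc)
  from Suc.IH[OF this 1] have "(P - 1) * y \<in> A" .
  from left_ideal_diff[OF A Suc.prems(2) this] show ?case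
    by (simp add: algebra_simps)
qed simp

text \<open>On vectors killed by \<open>q\<close>, the element \<open>q\<close> acts as \<open>- p\<close> times differentiation with respect
  to \<open>e\<close>.\<close>

lemma QE_power: "Q * E ^ Suc i = E ^ Suc i * Q - of_nat (Suc i) * (E ^ i * P)"
proof (induction i)
  case 0
  show ?case by (simp add: commutation(8))
next
  case (Suc i)
  have PE: "P * E ^ k = E ^ k * P" for k
    by (rule power_commuting_commutes[symmetric]) (simp add: commutation(7))
  have "Q * E ^ Suc (Suc i) = (Q * E) * E ^ Suc i"
    by (simp add: mult.assoc)
  also have "\<dots> = E * (Q * E ^ Suc i) - E ^ Suc i * P"
    unfolding commutation(8) left_diff_distrib PE by (simp add: mult.assoc)
  also have "\<dots> = E ^ Suc (Suc i) * Q - of_nat (Suc (Suc i)) * (E ^ Suc i * P)"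
  proof -
    have "E * (of_nat (Suc i) * (E ^ i * P)) = of_nat (Suc i) * (E ^ Suc i * P)"
      by (simp only: of_nat_left_commute power_Suc mult.assoc)
    then show ?thesis
      unfolding Suc right_diff_distrib by (simp add: algebra_simps)
  qed
  finally show ?case .
qed

text \<open>Applying \<open>q\<close> differentiates the relation with respect to \<open>e\<close> and lowers its degree, at the cost of
  an application of the injective \<open>p\<close> to the coefficients.\<close>

lemma independent_E:
  assumes A: "left_ideal A" and "\<And>i. unipotent_mod A (a i)"
    and "(\<Sum>i\<le>n. E ^ i * a i) \<in> A" "i \<le> n"
  shows "a i \<in> A"
  using assms(2-4)
proof (induction n arbitrary: a i)
  case 0
  then show ?case by simp
next
  case (Suc n)
  define b where "b i = of_nat (Suc i) * (P * a (Suc i))" for i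
  have b: "E ^ i * b i = E ^ Suc i * (Q * a (Suc i)) - Q * (E ^ Suc i * a (Suc i))" for i
  proof -
    have "E ^ i * b i = of_nat (Suc i) * (E ^ i * P) * a (Suc i)"
      unfolding b_def by (simp only: of_nat_left_commute mult.assoc)
    also have "\<dots> = (E ^ Suc i * Q - Q * E ^ Suc i) * a (Suc i)"
      unfolding QE_power by simp
    finally show ?thesis by (simp only: left_diff_distrib mult.assoc)
  qed
  have Qa: "Q * a i \<in> A" for i
    using Suc.prems(1)[of i] by (simp add: unipotent_mod_def)
  have split: "(\<Sum>i\<le>Suc n. E ^ i * a i) = a 0 + (\<Sum>i\<le>n. E ^ Suc i * a (Suc i))"
    by (simp only: sum.atMost_Suc_shift power_0 mult_1_left)
  have "(\<Sum>i\<le>n. E ^ i * b i) = (\<Sum>i\<le>n. E ^ Suc i * (Q * a (Suc i)))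
      - (Q * (\<Sum>i\<le>Suc n. E ^ i * a i) - Q * a 0)"
    unfolding b sum_subtractf split distrib_left sum_distrib_left by simp
  also have "\<dots> \<in> A"
    by (intro left_ideal_diff left_ideal_sum left_ideal_mult A Qa Suc.prems(2))
  finally have "b i \<in> A" if "i \<le> n" for i
    using Suc.IH[of b i] that unipotent_mod_P[OF A Suc.prems(1)] unfolding b_def by blast
  then have "P * a (Suc i) \<in> A" if "i \<le> n" for i
    using that left_ideal_const_cancel[OF A, of "of_nat (Suc i)"]
    unfolding b_def uea_const_of_nat by (metis of_nat_neq_0)
  then have pos: "a (Suc i) \<in> A" if "i \<le> n" for i
    using that Suc.prems(1)[of "Suc i"] unipotent_mod_P_cancel[OF A]
    by (auto simp: unipotent_mod_def)
  then have "(\<Sum>i\<le>n. E ^ Suc i * a (Suc i)) \<in> A"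
    by (intro left_ideal_sum left_ideal_mult A) auto
  from left_ideal_diff[OF A Suc.prems(2) this] have "a 0 \<in> A"
    unfolding split by simp
  with pos Suc.prems(3) show ?case by (cases i) auto
qed

text \<open>If the cyclic vector of \<open>U / A\<close> is a quasi-Whittaker vector, then so are its images under
  polynomials in \<open>f\<close>, and sums of \<open>h\<^sup>j\<close> times such images are unipotent for \<open>p\<close>.  So the two
  independence statements apply one after the other.  The coefficients are determined only as
  polynomials in \<open>f\<close> acting on the cyclic vector, because \<open>f\<close> may be algebraic on it.\<close>

lemma normal_form_unique:
  assumes A: "left_ideal A" and 1: "whittaker_mod A 1" and G: "evE G \<in> A"
  shows "evF (coeff (coeff G i) j) \<in> A"
proof -
  have W: "whittaker_mod A (evF g)" for g
    using whittaker_mod_evF[OF A 1, of g] by simp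
  have "unipotent_mod A (evF g)" for g
    using W[of g] by (auto simp: whittaker_mod_def unipotent_mod_def intro!: exI[of _ 1])
  then have U: "unipotent_mod A (evH k)" for k
    by (induction k) (simp_all add: unipotent_mod_add[OF A] unipotent_mod_H[OF A],
        simp add: unipotent_mod_def left_ideal_zero[OF A])
  have "evH (coeff G i) \<in> A"
  proof (cases "i \<le> degree G")
    case True
    then show ?thesis
      using independent_E[OF A U] G unfolding poly_sum_def[of E] by blast
  qed (simp add: coeff_eq_0 left_ideal_zero[OF A])
  then show ?thesis
    using independent_H[OF A W] unfolding poly_sum_def[of H]
    by (cases "j \<le> degree (coeff G i)") (auto simp: coeff_eq_0 left_ideal_zero[OF A])
qed

section \<open>Maximal left ideals and eigenvectors\<close>

text \<open>This is the simplicity of \<open>L\<close>: a proper left ideal containing \<open>p - 1\<close>, \<open>q\<close>, \<open>z\<close> and \<open>f - \<xi>\<close>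
  is maximal.  Modulo \<open>I\<close> an element is a combination of the \<open>e\<^sup>i h\<^sup>j\<close> with scalar coefficients, as \<open>f\<close>
  may be replaced by \<open>\<xi>\<close>.  If it lies in the proper left ideal \<open>A\<close>, then so does each of these
  scalars, which therefore vanish.\<close>

lemma maximal_left_ideal_eq:
  assumes I: "left_ideal I" "P - 1 \<in> I" "Q \<in> I" "Z \<in> I" "F - uea_const \<xi> \<in> I"
    and A: "left_ideal A" "1 \<notin> A" "I \<subseteq> A"
  shows "A = I"
proof
  show "A \<subseteq> I"
  proof
    fix u assume u: "u \<in> A"
    have red: "evF g - uea_const (poly g \<xi>) \<in> I" for g
    proof (induction g)
      case 0
      then show ?case by (simp add: left_ideal_zero[OF I(1)])
    next
      case (pCons c g)
      have "F * (evF g - uea_const (poly g \<xi>)) + uea_const (poly g \<xi>) * (F - uea_const \<xi>) \<in> I"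
        by (intro left_ideal_add left_ideal_mult I(1,5) pCons)
      then show ?case
        by (simp add: algebra_simps uea_const_add uea_const_central[of _ F] flip: uea_const_mult)
    qed
    obtain G where G: "u - evE G \<in> I"
      using normal_form[OF I(1-4)] by blast
    with u A have "evE G \<in> A"
      using left_ideal_cong by blast
    moreover have "whittaker_mod A 1"
      using I A(3) by (auto simp: whittaker_mod_def)
    ultimately have "evF (coeff (coeff G i) j) \<in> A" for i j
      using normal_form_unique[OF A(1)] by blast
    then have "uea_const (poly (coeff (coeff G i) j) \<xi>) * 1 \<in> A" for i j
      using red A left_ideal_cong by (metis mult.right_neutral subsetD)
    then have "poly (coeff (coeff G i) j) \<xi> = 0" for i j
      using A left_ideal_const_cancel by blast
    then have "evF (coeff (coeff G i) j) \<in> I" for i j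
      using red[of "coeff (coeff G i) j"] by simp
    then have "evE G \<in> I"
      unfolding poly_sum_def[of E] poly_sum_def[of H]
      by (intro left_ideal_sum left_ideal_mult I(1))
    with G show "u \<in> I"
      using left_ideal_cong[OF I(1)] by blast
  qed
qed (use A in blast)

text \<open>Splitting off linear factors of \<open>g\<close> over the complex numbers, one meets a factor whose removal
  leads out of \<open>A\<close>, because a nonzero constant is not in \<open>A\<close>.\<close>

lemma annihilating_polynomial_root:
  assumes A: "left_ideal A" "1 \<notin> A" and g: "evF g \<in> A" "g \<noteq> 0"
  shows "\<exists>g' \<xi>. evF g' \<notin> A \<and> (F - uea_const \<xi>) * evF g' \<in> A"
  using g
proof (induction "degree g" arbitrary: g rule: less_induct)
  case less
  have "degree g \<noteq> 0"
  proof
    assume "degree g = 0"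
    then obtain c where "g = [:c:]" using degree_eq_zeroE by blast
    with less.prems have "uea_const c * 1 \<in> A" "c \<noteq> 0" by auto
    with A show False using left_ideal_const_cancel by blast
  qed
  then obtain \<xi> where "poly g \<xi> = 0"
    using fundamental_theorem_of_algebra by (metis constant_degree)
  then obtain g' where g': "g = [:- \<xi>, 1:] * g'"
    unfolding poly_eq_0_iff_dvd by (elim dvdE)
  have "g = pCons 0 g' + smult (- \<xi>) g'"
    unfolding g' by simp
  then have "evF g = (F - uea_const \<xi>) * evF g'"
    by (simp only: ev_simps evF_smult uea_const_minus left_diff_distrib) simp
  moreover have "g' \<noteq> 0" using g' less.prems by auto
  moreover have "degree g = Suc (degree g')"
    using \<open>g' \<noteq> 0\<close> unfolding g' by (subst degree_mult_eq) auto
  ultimately show ?case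
    using less by (cases "evF g' \<in> A") auto
qed

text \<open>In the module \<open>U / A\<close> with cyclic vector \<open>v\<close>: if \<open>f v \<noteq> 0\<close>, then by maximality \<open>v = r f v\<close> for
  some \<open>r\<close>.  Writing \<open>r\<close> in normal form and comparing the coefficients at \<open>e\<^sup>0 h\<^sup>0\<close> gives
  \<open>v = g(f) f v\<close> for a polynomial \<open>g\<close>.  So \<open>v\<close> is killed by the nonzero polynomial \<open>X g - 1\<close> in \<open>f\<close>,
  and one of its factors produces an eigenvector of \<open>f\<close> which is again a quasi-Whittaker vector.\<close>

lemma exists_eigenvector:
  assumes A: "left_ideal A" "1 \<notin> A" "P - 1 \<in> A" "Q \<in> A" "Z \<in> A"
    and max: "\<And>B. left_ideal B \<Longrightarrow> A \<subseteq> B \<Longrightarrow> F \<in> B \<Longrightarrow> F \<notin> A \<Longrightarrow> 1 \<in> B"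
  shows "\<exists>y \<xi>. y \<notin> A \<and> whittaker_mod A y \<and> (F - uea_const \<xi>) * y \<in> A"
proof -
  have 1: "whittaker_mod A 1" using A by (simp add: whittaker_mod_def)
  show ?thesis
  proof (cases "F \<in> A")
    case True
    with A 1 show ?thesis by (intro exI[of _ 1] exI[of _ 0]) simp
  next
    case False
    let ?B = "{u. \<exists>r. u - r * F \<in> A}"
    have "left_ideal ?B" by (rule left_ideal_adjoin[OF A(1)])
    moreover have "A \<subseteq> ?B" by (auto intro!: exI[of _ 0])
    moreover have "F \<in> ?B" using left_ideal_zero[OF A(1)] by (auto intro!: exI[of _ 1])
    ultimately obtain r where r: "1 - r * F \<in> A"
      using max False by blast
    \<comment> \<open>Modulo this smaller left ideal, normal forms may be multiplied by \<open>f\<close> from the right.\<close>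
    define J where "J = {u \<in> A. u * F \<in> A}"
    have WF: "whittaker_mod A F" using whittaker_mod_F[OF A(1) 1] by simp
    have "left_ideal J"
      using A(1) by (auto simp: J_def left_ideal_def distrib_right mult.assoc)
    moreover have "P - 1 \<in> J" "Q \<in> J" "Z \<in> J"
      using A WF by (simp_all add: J_def whittaker_mod_def)
    ultimately obtain G where "r - evE G \<in> J"
      using normal_form by blast
    then have "(r - evE G) * F \<in> A" by (simp add: J_def)
    from left_ideal_add[OF A(1) this r] have "1 - evE G * F \<in> A"
      by (simp add: algebra_simps)
    then have 2: "evE G * F - 1 \<in> A"
      using left_ideal_uminus[OF A(1)] by fastforce
    \<comment> \<open>Right multiplication by \<open>f\<close> is multiplication by the variable in the innermost coefficients.\<close>
    define G' where "G' = map_poly (map_poly (pCons 0)) G"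
    have "evE G' = evE G * F"
      unfolding G'_def by (intro poly_sum_map_poly) (simp_all add: evF_commute)
    with 2 have "evE (G' + [:[:[:-1:]:]:]) \<in> A"
      by (simp add: uea_const_minus uea_const_1)
    from normal_form_unique[OF A(1) 1 this, of 0 0]
    have "evF (pCons 0 (coeff (coeff G 0) 0) + [:-1:]) \<in> A"
      by (simp add: G'_def coeff_map_poly)
    moreover have "pCons 0 (coeff (coeff G 0) 0) + [:-1:] \<noteq> 0"
      by simp
    ultimately obtain g' \<xi> where "evF g' \<notin> A \<and> (F - uea_const \<xi>) * evF g' \<in> A"
      using annihilating_polynomial_root[OF A(1,2)] by blast
    with whittaker_mod_evF[OF A(1) 1, of g'] show ?thesis
      by (intro exI[of _ "evF g'"] exI[of _ \<xi>]) simp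
  qed
qed

end

section \<open>Presentations of modules\<close>

text \<open>The structure \<open>A\<close> is the quotient of \<open>'x\<close> by \<open>K\<close>, with \<open>\<pi>\<close> as projection and operations
  induced by \<open>sm\<close> and \<open>ac\<close>.  Taking quotients again only enlarges \<open>K\<close>, so the tensor
  construction, the coset modules formed from it, and cyclic modules can be compared by comparing
  subsets of one type.  The operations on \<open>'x\<close> itself need not satisfy the module laws, as
  happens for the free abelian group from which the tensor product is formed.\<close>

definition presents ::
    "(complex \<Rightarrow> 'x \<Rightarrow> 'x) \<Rightarrow> ('l \<Rightarrow> 'x \<Rightarrow> 'x) \<Rightarrow> ('l, 'v) lie_module \<Rightarrow>
     ('x::ab_group_add \<Rightarrow> 'v) \<Rightarrow> 'x set \<Rightarrow> bool" where
  "presents sm ac A \<pi> K \<longleftrightarrow>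
     carrier A = range \<pi> \<and> \<zero>\<^bsub>A\<^esub> = \<pi> 0 \<and>
     (\<forall>x y. \<pi> x \<oplus>\<^bsub>A\<^esub> \<pi> y = \<pi> (x + y)) \<and>
     (\<forall>c x. c \<odot>\<^bsub>A\<^esub> \<pi> x = \<pi> (sm c x)) \<and>
     (\<forall>l x. act A l (\<pi> x) = \<pi> (ac l x)) \<and>
     (\<forall>x y. \<pi> x = \<pi> y \<longleftrightarrow> x - y \<in> K)"

lemma presents_iso:
  assumes A: "presents sm ac A \<pi> K" and B: "presents sm ac B \<rho> K"
  shows "A \<cong>\<^sub>L B"
proof -
  define T where "T v = \<rho> (SOME x. \<pi> x = v)" for v
  have T: "T (\<pi> x) = \<rho> x" for x
  proof -
    have "\<pi> (SOME y. \<pi> y = \<pi> x) = \<pi> x"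
      by (rule someI) (rule refl)
    then show ?thesis
      using A B by (simp add: T_def presents_def)
  qed
  have "T ` range \<pi> = range \<rho>"
    by (simp add: image_image T)
  then have "bij_betw T (carrier A) (carrier B)"
    unfolding bij_betw_def inj_on_def using A B by (auto simp: presents_def T)
  then have "lie_module_iso T A B"
    using A B by (auto simp: lie_module_iso_def presents_def T)
  then show ?thesis
    unfolding lie_module_isomorphic_def by blast
qed

lemma presents_quotient:
  assumes A: "presents sm ac A \<pi> K" and KI: "K \<subseteq> I"
    and I: "0 \<in> I" "\<And>x y. x \<in> I \<Longrightarrow> y \<in> I \<Longrightarrow> x + y \<in> I" "\<And>x. x \<in> I \<Longrightarrow> - x \<in> I"
    and sm: "\<And>c x y. sm c (x - y) = sm c x - sm c y" "\<And>c x. x \<in> I \<Longrightarrow> sm c x \<in> I"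
    and ac: "\<And>l x y. ac l (x - y) = ac l x - ac l y" "\<And>l x. x \<in> I \<Longrightarrow> ac l x \<in> I"
  shows "presents sm ac (A /\<^sub>L \<pi> ` I) (\<lambda>x. \<pi> ` I +>\<^bsub>A\<^esub> \<pi> x) I"
proof -
  define c where "c x = \<pi> ` I +>\<^bsub>A\<^esub> \<pi> x" for x
  note A' = A[unfolded presents_def]
  have diff: "x - y \<in> I" if "x \<in> I" "y \<in> I" for x y
    using I(2)[OF that(1) I(3)[OF that(2)]] by simp
  have c_iff: "v \<in> c x \<longleftrightarrow> (\<exists>y. v = \<pi> y \<and> y - x \<in> I)" for v x
  proof
    assume "v \<in> c x"
    then show "\<exists>y. v = \<pi> y \<and> y - x \<in> I"
      using A' by (auto simp: c_def a_r_coset_def')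
  next
    assume "\<exists>y. v = \<pi> y \<and> y - x \<in> I"
    then obtain y where "v = \<pi> (y - x) \<oplus>\<^bsub>A\<^esub> \<pi> x" "y - x \<in> I"
      using A' by auto
    then show "v \<in> c x"
      by (auto simp: c_def a_r_coset_def')
  qed
  have self: "\<pi> x \<in> c x" for x
    unfolding c_iff using I(1) by (intro exI[of _ x]) simp
  have eqI: "c x = c y" if xy: "x - y \<in> I" for x y
  proof -
    have "u - x \<in> I \<longleftrightarrow> u - y \<in> I" for u
      using I(2)[of "u - x" "x - y"] diff[of "u - y" "x - y"] xy by auto
    then show ?thesis by (auto simp: c_iff)
  qed
  have eq: "c x = c y \<longleftrightarrow> x - y \<in> I" for x y
  proof
    assume "c x = c y"
    then have "\<pi> x \<in> c y" using self[of x] by simp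
    then obtain u where "\<pi> x = \<pi> u" "u - y \<in> I" by (auto simp: c_iff)
    then have "x - u \<in> I" using A' KI by auto
    from I(2)[OF this \<open>u - y \<in> I\<close>] show "x - y \<in> I" by simp
  qed (rule eqI)
  have union: "(\<Union>v\<in>c x. \<pi> ` I +>\<^bsub>A\<^esub> g v) = c (s x)"
    if g: "\<And>u. g (\<pi> u) = \<pi> (s u)" "\<And>u. u - x \<in> I \<Longrightarrow> s u - s x \<in> I" for x s g
  proof -
    have "\<pi> ` I +>\<^bsub>A\<^esub> g v = c (s x)" if v: "v \<in> c x" for v
    proof -
      from v obtain u where "v = \<pi> u" "u - x \<in> I" by (auto simp: c_iff)
      then show ?thesis using g eqI[of "s u" "s x"] by (simp add: c_def)
    qed
    then show ?thesis using self[of x] by auto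
  qed
  have "c 0 = \<pi> ` I"
    by (auto simp: c_iff)
  moreover have "carrier (A /\<^sub>L \<pi> ` I) = range c"
    using A' by (auto simp: quot_lie_module_def A_RCOSETS_def' c_def)
  moreover have "c x <+>\<^bsub>A\<^esub> c y = c (x + y)" for x y
  proof (intro equalityI subsetI)
    fix v assume "v \<in> c x <+>\<^bsub>A\<^esub> c y"
    then obtain a b where "v = \<pi> a \<oplus>\<^bsub>A\<^esub> \<pi> b" "a - x \<in> I" "b - y \<in> I"
      by (auto simp: set_add_def' c_iff)
    then show "v \<in> c (x + y)"
      using A' I(2)[of "a - x" "b - y"] unfolding c_iff
      by (intro exI[of _ "a + b"]) (simp add: algebra_simps)
  next
    fix v assume "v \<in> c (x + y)"
    then obtain a where a: "v = \<pi> a" "a - (x + y) \<in> I"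
      by (auto simp: c_iff)
    then have "v = \<pi> (a - y) \<oplus>\<^bsub>A\<^esub> \<pi> y"
      using A' by simp
    moreover have "\<pi> (a - y) \<in> c x"
      using a(2) unfolding c_iff by (intro exI[of _ "a - y"]) (simp add: algebra_simps)
    ultimately show "v \<in> c x <+>\<^bsub>A\<^esub> c y"
      using self[of y] by (auto simp: set_add_def')
  qed
  moreover have "(\<Union>v\<in>c x. \<pi> ` I +>\<^bsub>A\<^esub> (k \<odot>\<^bsub>A\<^esub> v)) = c (sm k x)" for k x
    using A' sm(2) by (intro union) (simp_all flip: sm(1))
  moreover have "(\<Union>v\<in>c x. \<pi> ` I +>\<^bsub>A\<^esub> (act A l v)) = c (ac l x)" for l x
    using A' ac(2) by (intro union) (simp_all flip: ac(1))
  ultimately show ?thesis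
    unfolding presents_def c_def[symmetric] using eq by (simp add: quot_lie_module_def)
qed

text \<open>The cyclic case: a quotient of the enveloping algebra, the image of \<open>1\<close> being the cyclic vector.\<close>

abbreviation uea_presents ::
    "('l::complex_lie_algebra, 'v) lie_module \<Rightarrow> ('l uea \<Rightarrow> 'v) \<Rightarrow> 'l uea set \<Rightarrow> bool" where
  "uea_presents \<equiv> presents (\<lambda>c u. uea_const c * u) (\<lambda>x u. uea_gen x * u)"

lemma presents_finsum:
  assumes A: "presents sm ac A \<pi> K"
  shows "(\<Oplus>\<^bsub>A\<^esub>i\<in>S. \<pi> (g i)) = \<pi> (sum g S)"
proof -
  note A' = A[unfolded presents_def]
  interpret abelian_monoid A
    by (rule abelian_monoidI) (use A' in \<open>auto simp: algebra_simps\<close>)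
  show ?thesis
    using A' by (induction S rule: infinite_finite_induct) auto
qed

lemma uea_presents_act:
  assumes A: "uea_presents A \<pi> K"
  shows "uea_act A u (\<pi> u') = \<pi> (u * u')"
proof -
  note A' = A[unfolded presents_def]
  have w: "word_act A w (\<pi> u') = \<pi> (prod_list (map uea_gen (letters w)) * u')" for w
  proof -
    have "foldr (act A) xs (\<pi> u') = \<pi> (prod_list (map uea_gen xs) * u')" for xs
      using A' by (induction xs) (simp_all add: mult.assoc)
    then show ?thesis by (simp add: word_act_def)
  qed
  have abs: "abs_uea t = (\<Sum>w\<in>Poly_Mapping.keys t. abs_uea (Poly_Mapping.single w (Poly_Mapping.lookup t w)))"
    for t :: "'a free_alg"
  proof (induction t rule: poly_mapping_additive_induct)
    case (1 w c)
    show ?case by (cases "c = 0") (simp_all flip: zero_uea.abs_eq)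
  next
    case (2 s t)
    have "(\<Sum>w\<in>Poly_Mapping.keys (s + t). abs_uea (Poly_Mapping.single w (Poly_Mapping.lookup (s + t) w)))
      = (\<Sum>w\<in>Poly_Mapping.keys s. abs_uea (Poly_Mapping.single w (Poly_Mapping.lookup s w)))
      + (\<Sum>w\<in>Poly_Mapping.keys t. abs_uea (Poly_Mapping.single w (Poly_Mapping.lookup t w)))"
      by (rule sum_keys_add) (simp_all add: single_add plus_uea.abs_eq zero_uea.abs_eq)
    with 2 show ?case by (simp flip: plus_uea.abs_eq)
  qed
  have "free_act A t (\<pi> u') = \<pi> (abs_uea t * u')" for t
    unfolding free_act_def
    using A' by (subst abs) (simp add: w presents_finsum[OF A] abs_uea_single sum_distrib_right mult.assoc)
  then show ?thesis by (simp add: uea_act_def abs_rep_uea)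
qed

lemma uea_presents_cyclic_quotient:
  assumes A: "uea_presents A \<pi> J" and J: "left_ideal J"
  shows "uea_presents (A /\<^sub>L cyclic_submodule A (\<pi> y)) (\<lambda>u. cyclic_submodule A (\<pi> y) +>\<^bsub>A\<^esub> \<pi> u)
    {u. \<exists>r. u - r * y \<in> J}"
proof -
  let ?I = "{u. \<exists>r. u - r * y \<in> J}"
  note I = left_ideal_adjoin[OF J, of y]
  have "cyclic_submodule A (\<pi> y) = \<pi> ` ?I"
  proof
    have "u * y \<in> ?I" for u
      using left_ideal_zero[OF J] by (auto intro!: exI[of _ u])
    then show "cyclic_submodule A (\<pi> y) \<subseteq> \<pi> ` ?I"
      by (auto simp: cyclic_submodule_def uea_presents_act[OF A])
    show "\<pi> ` ?I \<subseteq> cyclic_submodule A (\<pi> y)"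
      using A by (auto simp: cyclic_submodule_def uea_presents_act[OF A] presents_def)
  qed
  moreover have "J \<subseteq> ?I" by (auto intro!: exI[of _ 0])
  then have "uea_presents (A /\<^sub>L \<pi> ` ?I) (\<lambda>u. \<pi> ` ?I +>\<^bsub>A\<^esub> \<pi> u) ?I"
    by (intro presents_quotient[OF A] right_diff_distrib left_ideal_zero[OF I]
        left_ideal_add[OF I] left_ideal_uminus[OF I] left_ideal_mult[OF I])
  ultimately show ?thesis by simp
qed

section \<open>The kernel of the universal module\<close>

lemma lie_module_one_dim:
  assumes "lie_hom \<phi>"
  shows "lie_module (one_dim_module \<phi>)"
proof -
  have cr: "cring complex_ring"
  proof (intro cringI abelian_groupI comm_monoidI)
    fix x :: complex
    show "\<exists>y\<in>carrier complex_ring. y \<oplus>\<^bsub>complex_ring\<^esub> x = \<zero>\<^bsub>complex_ring\<^esub>"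
      by (auto intro: exI[of _ "- x"])
  qed (auto simp: algebra_simps)
  have ab: "abelian_group (one_dim_module \<phi>)"
  proof (rule abelian_groupI)
    fix x
    show "\<exists>y\<in>carrier (one_dim_module \<phi>). y \<oplus>\<^bsub>one_dim_module \<phi>\<^esub> x = \<zero>\<^bsub>one_dim_module \<phi>\<^esub>"
      by (auto simp: one_dim_module_def intro: exI[of _ "- x"])
  qed (auto simp: one_dim_module_def)
  interpret N: abelian_group "one_dim_module \<phi>" by (rule ab)
  have inv: "\<ominus>\<^bsub>one_dim_module \<phi>\<^esub> x = - x" for x
    using N.minus_equality[of "- x" x] by (simp add: one_dim_module_def)
  have minus: "x \<ominus>\<^bsub>one_dim_module \<phi>\<^esub> y = x - y" for x y
    by (simp add: a_minus_def inv) (simp add: one_dim_module_def)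
  show ?thesis
  proof (intro lie_module.intro moduleI cr ab lie_module_axioms.intro)
    fix x y v assume "v \<in> carrier (one_dim_module \<phi>)"
    show "act (one_dim_module \<phi>) (bracket x y) v =
        act (one_dim_module \<phi>) x (act (one_dim_module \<phi>) y v) \<ominus>\<^bsub>one_dim_module \<phi>\<^esub>
        act (one_dim_module \<phi>) y (act (one_dim_module \<phi>) x v)"
      using assms unfolding minus by (simp add: one_dim_module_def lie_hom_def bracket_complex_def)
  qed (use assms in \<open>auto simp: one_dim_module_def lie_hom_def cscale_complex_def algebra_simps\<close>)
qed

text \<open>The map \<open>u \<otimes> n \<mapsto> n u\<close>, on formal sums of pairs.\<close>

definition contract :: "('g::complex_lie_algebra uea \<times> complex \<Rightarrow>\<^sub>0 int) \<Rightarrow> 'g uea" where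
  "contract t = (\<Sum>k\<in>Poly_Mapping.keys t. of_int (Poly_Mapping.lookup t k) * (fst k * uea_const (snd k)))"

lemma uea_lmult_diff: "uea_lmult a (s - t) = uea_lmult a s - uea_lmult a t"
  by (simp add: uea_lmult_def frag_extend_diff)

lemma contract_add: "contract (s + t) = contract s + contract t"
  unfolding contract_def by (rule sum_keys_add) (simp_all add: distrib_right)

lemma contract_0: "contract 0 = 0"
  by (simp add: contract_def)

lemma contract_diff: "contract (s - t) = contract s - contract t"
  using contract_add[of "s - t" t] by simp

lemma contract_frag_of: "contract (frag_of (u, n)) = u * uea_const n"
  by (simp add: contract_def)

locale induced_one_dim =
  fixes \<iota> :: "heisenberg \<Rightarrow> 'g::complex_lie_algebra" and \<phi> :: "heisenberg \<Rightarrow> complex"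
  assumes \<iota>: "lie_hom \<iota>" and \<phi>: "lie_hom \<phi>"
begin

abbreviation "N \<equiv> one_dim_module \<phi>"
abbreviation "K \<equiv> tensor_kernel \<iota> N"
abbreviation "gens \<equiv> range (\<lambda>x. uea_gen (\<iota> x) - uea_const (\<phi> x))"

sublocale N: lie_module N
  by (rule lie_module_one_dim[OF \<phi>])

lemma N_carrier [simp]: "x \<in> carrier N"
  by (simp add: one_dim_module_def)

lemma N_add: "x \<oplus>\<^bsub>N\<^esub> y = x + y" and N_smult: "x \<odot>\<^bsub>N\<^esub> y = x * y" and N_act: "act N l y = \<phi> l * y"
  by (simp_all add: one_dim_module_def)

text \<open>In the quotient by the left ideal generated by the elements \<open>\<iota> x - \<phi> x\<close>, all of the subalgebra
  acts on the cyclic vector as it acts on the one-dimensional module.\<close>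

lemma uea_map_minus_act:
  assumes A: "left_ideal A" "gens \<subseteq> A"
  shows "uea_map \<iota> a * uea_const n - uea_const (uea_act N a n) \<in> A"
proof (induction a rule: uea_induct)
  case one
  show ?case
    by (simp add: uea_map_hom[OF \<iota>] N.uea_act_hom left_ideal_zero A)
next
  case (add u u')
  have "(uea_map \<iota> u * uea_const n - uea_const (uea_act N u n)) +
     (uea_map \<iota> u' * uea_const n - uea_const (uea_act N u' n)) \<in> A"
    by (intro left_ideal_add A add)
  then show ?case
    by (simp add: uea_map_hom[OF \<iota>] N.uea_act_hom N_add uea_const_add algebra_simps)
next
  case (const c u)
  have "uea_const c * (uea_map \<iota> u * uea_const n - uea_const (uea_act N u n)) \<in> A"
    by (intro left_ideal_mult A const)
  then show ?case
    by (simp add: uea_map_hom[OF \<iota>] N.uea_act_hom N_smult uea_const_mult right_diff_distrib mult.assoc)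
next
  case (gen x u)
  let ?c = "uea_const (uea_act N u n)"
  have "uea_gen (\<iota> x) * (uea_map \<iota> u * uea_const n - ?c) + ?c * (uea_gen (\<iota> x) - uea_const (\<phi> x)) \<in> A"
    using A by (intro left_ideal_add left_ideal_mult gen) auto
  also have "uea_gen (\<iota> x) * (uea_map \<iota> u * uea_const n - ?c) + ?c * (uea_gen (\<iota> x) - uea_const (\<phi> x))
      = uea_gen (\<iota> x) * uea_map \<iota> u * uea_const n - uea_const (\<phi> x) * ?c"
    by (simp add: right_diff_distrib mult.assoc uea_const_central[of _ "uea_gen (\<iota> x)"]
        uea_const_central[of "\<phi> x" ?c])
  finally show ?case
    by (simp add: uea_map_hom[OF \<iota>] N.uea_act_hom N_act uea_const_mult)
qed

lemma K_zero: "0 \<in> K"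
  unfolding tensor_kernel_def using generate.one[of "free_Abelian_group (UNIV \<times> carrier N)"] by simp

lemma K_add: "s \<in> K \<Longrightarrow> t \<in> K \<Longrightarrow> s + t \<in> K"
  unfolding tensor_kernel_def using generate.eng[of s "free_Abelian_group (UNIV \<times> carrier N)"] by simp

lemma K_rels: "s \<in> tensor_rels \<iota> N \<Longrightarrow> s \<in> K"
  unfolding tensor_kernel_def by (rule generate.incl)

lemma K_induct [consumes 1, case_names zero rel neg add]:
  assumes "t \<in> K" "P 0" "\<And>r. r \<in> tensor_rels \<iota> N \<Longrightarrow> P r" "\<And>r. r \<in> tensor_rels \<iota> N \<Longrightarrow> P (- r)"
    "\<And>s t. s \<in> K \<Longrightarrow> t \<in> K \<Longrightarrow> P s \<Longrightarrow> P t \<Longrightarrow> P (s + t)"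
  shows "P t"
proof -
  have c: "Poly_Mapping.keys r \<subseteq> UNIV \<times> carrier N" for r :: "'g uea \<times> complex \<Rightarrow>\<^sub>0 int"
    by auto
  show ?thesis
    using assms(1) unfolding tensor_kernel_def
    by (induction rule: generate.induct) (use assms(2-) c in \<open>simp_all add: tensor_kernel_def\<close>)
qed

lemma K_uminus: "t \<in> K \<Longrightarrow> - t \<in> K"
proof (induction rule: K_induct)
  case (neg r)
  then show ?case by (simp add: K_rels)
next
  case (add s t)
  then show ?case using K_add[of "- s" "- t"] by simp
next
  case (rel r)
  have "Poly_Mapping.keys r \<subseteq> UNIV \<times> carrier N" by auto
  from inv_free_Abelian_group[OF this] show ?case
    using generate.inv[OF rel, of "free_Abelian_group (UNIV \<times> carrier N)"] by (simp add: tensor_kernel_def)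
qed (simp add: K_zero)

lemma K_diff: "s \<in> K \<Longrightarrow> t \<in> K \<Longrightarrow> s - t \<in> K"
  using K_add[of s "- t"] K_uminus[of t] by simp

lemma K_cong: "s - t \<in> K \<Longrightarrow> s \<in> K \<longleftrightarrow> t \<in> K"
  using K_add[of "s - t" t] K_diff[of s "s - t"] by auto

lemma K_lmult: "t \<in> K \<Longrightarrow> uea_lmult a t \<in> K"
proof (induction rule: K_induct)
  have rel: "uea_lmult a r \<in> K" if "r \<in> tensor_rels \<iota> N" for r
    using that
  proof cases
    case (1 n u u')
    then show ?thesis
      by (auto simp: uea_lmult_def frag_extend_diff distrib_left intro!: K_rels tensor_rels.intros)
  next
    case (2 n n' u)
    then show ?thesis
      by (auto simp: uea_lmult_def frag_extend_diff intro!: K_rels tensor_rels.intros)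
  next
    case (3 n u b)
    then show ?thesis
      using tensor_rels.intros(3)[of n N "a * u" \<iota> b]
      by (auto simp: uea_lmult_def frag_extend_diff mult.assoc intro!: K_rels)
  qed
  fix r assume r: "r \<in> tensor_rels \<iota> N"
  from rel[OF r] show "uea_lmult a r \<in> K" "uea_lmult a (- r) \<in> K"
    by (simp_all add: uea_lmult_def frag_extend_minus K_uminus)
next
  case (add s t)
  then show ?case by (simp add: uea_lmult_def frag_extend_add K_add)
qed (simp add: uea_lmult_def K_zero)

lemma K_gen_add: "frag_of (u + u', n) - frag_of (u, n) - frag_of (u', n) \<in> K"
  by (intro K_rels tensor_rels.intros) simp

lemma K_balanced: "frag_of (u * uea_map \<iota> a, n) - frag_of (u, uea_act N a n) \<in> K"
  by (intro K_rels tensor_rels.intros) simp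

lemma contract_K:
  assumes A: "left_ideal A" "gens \<subseteq> A" and t: "t \<in> K"
  shows "contract t \<in> A"
  using t
proof (induction rule: K_induct)
  have rel: "contract r \<in> A" if "r \<in> tensor_rels \<iota> N" for r
    using that
  proof cases
    case (1 n u u')
    then show ?thesis
      by (simp add: contract_diff contract_frag_of distrib_right left_ideal_zero A)
  next
    case (2 n n' u)
    then show ?thesis
      by (simp add: contract_diff contract_frag_of N_add uea_const_add distrib_left left_ideal_zero A)
  next
    case (3 n u b)
    then show ?thesis
      using left_ideal_mult[OF A(1) uea_map_minus_act[OF A, of b n], of u]
      by (simp add: contract_diff contract_frag_of mult.assoc right_diff_distrib)
  qed
  fix r assume r: "r \<in> tensor_rels \<iota> N"
  from rel[OF r] show "contract r \<in> A" "contract (- r) \<in> A"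
    using contract_diff[of 0 r] by (simp_all add: contract_0 left_ideal_uminus A)
next
  case (add s t)
  then show ?case by (simp add: contract_add left_ideal_add A)
qed (simp add: contract_0 left_ideal_zero A)

lemma frag_of_zero_K: "frag_of (0, n) \<in> K"
  using K_uminus[OF K_gen_add[of 0 0 n]] by simp

lemma frag_of_diff_K: "frag_of (u - u', n) - (frag_of (u, n) - frag_of (u', n)) \<in> K"
  using K_uminus[OF K_gen_add[of "u - u'" u' n]] by (simp add: algebra_simps)

text \<open>Every tensor is a pure tensor \<open>u \<otimes> 1\<close>, because \<open>u \<otimes> n = n u \<otimes> 1\<close>.\<close>

lemma minus_contract_K: "t - frag_of (contract t, 1) \<in> K"
proof -
  have "Poly_Mapping.keys t \<subseteq> UNIV" by simp
  then show ?thesis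
  proof (induction t rule: frag_induction)
    case zero
    then show ?case using K_uminus[OF frag_of_zero_K] by (simp add: contract_0)
  next
    case (one x)
    obtain u n where x: "x = (u, n)" by (cases x)
    have "frag_of (u * uea_const n, 1) - frag_of (u, n) \<in> K"
      using K_balanced[of u "uea_const n" 1]
      by (simp add: uea_map_hom[OF \<iota>] N.uea_act_hom N_smult)
    from K_uminus[OF this] show ?case by (simp add: x contract_frag_of)
  next
    case (diff s t)
    have "(s - frag_of (contract s, 1)) - (t - frag_of (contract t, 1))
        - (frag_of (contract s - contract t, 1) - (frag_of (contract s, 1) - frag_of (contract t, 1))) \<in> K"
      by (intro K_diff diff frag_of_diff_K)
    then show ?case by (simp add: contract_diff algebra_simps)
  qed
qed

text \<open>One inclusion contracts the tensor relations into the left ideal; for the other, the \<open>u\<close> with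
  \<open>u \<otimes> 1 = 0\<close> form a left ideal that contains the generators.\<close>

lemma frag_of_K_iff: "frag_of (u, 1) \<in> K \<longleftrightarrow> u \<in> left_ideal hull gens"
proof
  assume "frag_of (u, 1) \<in> K"
  moreover have "left_ideal (left_ideal hull gens)"
    by (rule hull_in) (auto simp: left_ideal_def)
  ultimately show "u \<in> left_ideal hull gens"
    using contract_K[of "left_ideal hull gens" "frag_of (u, 1)"] hull_subset[of gens left_ideal]
    by (simp add: contract_frag_of uea_const_1)
next
  have "left_ideal hull gens \<subseteq> {u. frag_of (u, 1) \<in> K}"
  proof (rule hull_minimal)
    show "gens \<subseteq> {u. frag_of (u, 1) \<in> K}"
    proof clarify
      fix x
      have "frag_of (uea_gen (\<iota> x), 1) - frag_of (1, \<phi> x) \<in> K"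
        using K_balanced[of 1 "uea_gen x" 1] by (simp add: uea_map_hom[OF \<iota>] N.uea_act_hom N_act)
      moreover have "frag_of (1, \<phi> x) - frag_of (uea_const (\<phi> x), 1) \<in> K"
        using minus_contract_K[of "frag_of (1, \<phi> x)"] by (simp add: contract_frag_of)
      ultimately have "(frag_of (uea_gen (\<iota> x) - uea_const (\<phi> x), 1)
          - (frag_of (uea_gen (\<iota> x), 1) - frag_of (uea_const (\<phi> x), 1)))
          + ((frag_of (uea_gen (\<iota> x), 1) - frag_of (1, \<phi> x))
          + (frag_of (1, \<phi> x) - frag_of (uea_const (\<phi> x), 1))) \<in> K"
        by (intro K_add frag_of_diff_K)
      then show "frag_of (uea_gen (\<iota> x) - uea_const (\<phi> x), 1) \<in> K"
        by simp
    qed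
    show "left_ideal {u. frag_of (u, 1) \<in> K}"
      unfolding left_ideal_def
    proof (intro conjI ballI allI)
      fix u u' assume "u \<in> {u. frag_of (u, 1) \<in> K}" "u' \<in> {u. frag_of (u, 1) \<in> K}"
      then have "(frag_of (u + u', 1) - frag_of (u, 1) - frag_of (u', 1)) + frag_of (u, 1) + frag_of (u', 1) \<in> K"
        by (intro K_add K_gen_add) auto
      then show "u + u' \<in> {u. frag_of (u, 1) \<in> K}" by simp
    next
      fix r u assume "u \<in> {u. frag_of (u, 1) \<in> K}"
      then show "r * u \<in> {u. frag_of (u, 1) \<in> K}"
        using K_lmult[of "frag_of (u, 1)" r] by (simp add: uea_lmult_def)
    qed (simp add: frag_of_zero_K)
  qed
  then show "u \<in> left_ideal hull gens \<Longrightarrow> frag_of (u, 1) \<in> K" by blast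
qed

text \<open>The map \<open>u \<mapsto> u \<otimes> 1\<close> is onto by \<open>minus_contract_K\<close>, and \<open>frag_of_K_iff\<close> gives its kernel.\<close>

lemma presents_induced_module:
  "uea_presents (induced_module \<iota> N) (\<lambda>u. pure_tensor \<iota> N u 1) (left_ideal hull gens)"
proof -
  let ?T = "tensor_pre N :: ('g, 'g uea \<times> complex \<Rightarrow>\<^sub>0 int) lie_module"
  let ?sm = "\<lambda>c. uea_lmult (uea_const c) :: ('g uea \<times> complex \<Rightarrow>\<^sub>0 int) \<Rightarrow> _"
  let ?ac = "\<lambda>x. uea_lmult (uea_gen x) :: ('g uea \<times> complex \<Rightarrow>\<^sub>0 int) \<Rightarrow> _"
  have "presents ?sm ?ac ?T (\<lambda>t. t) {0}"
    by (auto simp: presents_def tensor_pre_def)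
  then have "presents ?sm ?ac (?T /\<^sub>L (\<lambda>t. t) ` K) (\<lambda>t. (\<lambda>t. t) ` K +>\<^bsub>?T\<^esub> t) K"
    by (rule presents_quotient)
      (simp_all add: K_zero K_add K_uminus K_lmult uea_lmult_diff)
  then have pre: "presents ?sm ?ac (induced_module \<iota> N) (\<lambda>t. K +>\<^bsub>?T\<^esub> t) K"
    by (simp add: induced_module_def)
  note pre' = pre[unfolded presents_def]
  have "carrier (induced_module \<iota> N) = range (\<lambda>u. pure_tensor \<iota> N u 1)"
  proof -
    have "K +>\<^bsub>?T\<^esub> t = pure_tensor \<iota> N (contract t) 1" for t
      using pre' minus_contract_K[of t] unfolding pure_tensor_def by blast
    moreover have "pure_tensor \<iota> N u 1 \<in> range (\<lambda>t. K +>\<^bsub>?T\<^esub> t)" for u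
      by (simp add: pure_tensor_def)
    ultimately show ?thesis using pre' by auto
  qed
  moreover have "\<zero>\<^bsub>induced_module \<iota> N\<^esub> = pure_tensor \<iota> N 0 1"
    using pre' K_uminus[OF frag_of_zero_K] unfolding pure_tensor_def by simp
  moreover have "pure_tensor \<iota> N u 1 \<oplus>\<^bsub>induced_module \<iota> N\<^esub> pure_tensor \<iota> N u' 1 =
      pure_tensor \<iota> N (u + u') 1" for u u'
    using pre' K_uminus[OF K_gen_add[of u u' 1]] unfolding pure_tensor_def by (simp add: algebra_simps)
  moreover have "c \<odot>\<^bsub>induced_module \<iota> N\<^esub> pure_tensor \<iota> N u 1 = pure_tensor \<iota> N (uea_const c * u) 1" for c u
    using pre' unfolding pure_tensor_def by (simp add: uea_lmult_def)
  moreover have "act (induced_module \<iota> N) x (pure_tensor \<iota> N u 1) = pure_tensor \<iota> N (uea_gen x * u) 1" for x u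
    using pre' unfolding pure_tensor_def by (simp add: uea_lmult_def)
  moreover have "pure_tensor \<iota> N u 1 = pure_tensor \<iota> N u' 1 \<longleftrightarrow> u - u' \<in> left_ideal hull gens" for u u'
  proof -
    have "frag_of (u, 1) - frag_of (u', 1) \<in> K \<longleftrightarrow> frag_of (u - u', 1) \<in> K"
      using K_cong[OF frag_of_diff_K[of u u' 1]] by simp
    then show ?thesis
      using pre' unfolding pure_tensor_def frag_of_K_iff[symmetric] by blast
  qed
  ultimately show ?thesis by (simp add: presents_def)
qed

end

section \<open>Cyclic and simple modules as quotients of the enveloping algebra\<close>

lemma (in lie_module) uea_act_eq_iff:
  assumes v: "v \<in> carrier V"
  shows "uea_act V u v = uea_act V u' v \<longleftrightarrow> uea_act V (u - u') v = \<zero>"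
proof -
  have "uea_act V u v = uea_act V (u - u') v \<oplus> uea_act V u' v"
    using uea_act_hom(1)[OF v, of "u - u'" u'] by simp
  then show ?thesis
    using uea_act_closed[OF v] M.add.l_cancel_one' by auto
qed

lemma (in lie_module) uea_presents_cyclic:
  assumes v: "v \<in> carrier V" and cyc: "carrier V = cyclic_submodule V v"
  shows "uea_presents V (\<lambda>u. uea_act V u v) {u. uea_act V u v = \<zero>}"
proof -
  note uea_act_eq_iff[OF v]
  moreover have "\<zero> = uea_act V 0 v" "uea_act V u v \<oplus> uea_act V u' v = uea_act V (u + u') v"
    "c \<odot> uea_act V u v = uea_act V (uea_const c * u) v"
    "act V x (uea_act V u v) = uea_act V (uea_gen x * u) v" for u u' c x
    by (simp_all add: uea_act_hom v uea_act_closed)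
  ultimately show ?thesis
    unfolding presents_def using cyc unfolding cyclic_submodule_def by blast
qed

lemma (in lie_module) left_ideal_annihilator:
  assumes v: "v \<in> carrier V"
  shows "left_ideal {u. uea_act V u v = \<zero>}"
proof -
  have "uea_act V u \<zero> = \<zero>" for u
    by (simp add: uea_act_def free_act_on_zero)
  then show ?thesis by (auto simp: left_ideal_def uea_act_hom v)
qed

text \<open>In a simple module every nonzero submodule \<open>B v\<close> contains \<open>v\<close>: the annihilator of \<open>v\<close> is a maximal
  left ideal.\<close>

lemma (in lie_module) simple_annihilator_maximal:
  assumes v: "v \<in> carrier V" and cyc: "carrier V = cyclic_submodule V v"
    and simple: "simple_lie_module V"
    and B: "left_ideal B" "\<exists>b\<in>B. uea_act V b v \<noteq> \<zero>"
  shows "\<exists>b\<in>B. uea_act V (1 - b) v = \<zero>"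
proof -
  let ?N = "(\<lambda>u. uea_act V u v) ` B"
  have neg: "\<ominus> uea_act V b v = uea_act V (- b) v" for b
    using M.minus_equality[of "uea_act V (- b) v" "uea_act V b v"] uea_act_hom(1)[OF v, of "- b" b]
    by (simp add: uea_act_closed v uea_act_hom)
  have "submodule ?N complex_ring V"
  proof (rule submoduleI)
    show "?N \<subseteq> carrier V" by (auto simp: uea_act_closed v)
    show "\<zero> \<in> ?N"
      using left_ideal_zero[OF B(1)] uea_act_hom(6)[OF v] by (metis image_eqI)
    show "\<ominus> a \<in> ?N" if "a \<in> ?N" for a
      using that left_ideal_uminus[OF B(1)] by (auto simp: neg)
    show "a \<oplus> b \<in> ?N" if "a \<in> ?N" "b \<in> ?N" for a b
      using that left_ideal_add[OF B(1)] uea_act_hom(1)[OF v] by (auto, metis image_eqI)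
    show "c \<odot> a \<in> ?N" if "a \<in> ?N" for c a
    proof -
      from that obtain b where "b \<in> B" "a = uea_act V b v" by blast
      then have "c \<odot> a = uea_act V (uea_const c * b) v" "uea_const c * b \<in> B"
        by (simp_all add: uea_act_hom v uea_act_closed left_ideal_mult[OF B(1)])
      then show ?thesis by blast
    qed
  qed
  moreover have "act V x a \<in> ?N" if "a \<in> ?N" for x a
  proof -
    from that obtain b where "b \<in> B" "a = uea_act V b v" by blast
    then have "act V x a = uea_act V (uea_gen x * b) v" "uea_gen x * b \<in> B"
      by (simp_all add: uea_act_hom v uea_act_closed left_ideal_mult[OF B(1)])
    then show ?thesis by blast
  qed
  ultimately have "lie_submodule ?N V"
    by (auto simp: lie_submodule_def)
  with simple B(2) have "?N = carrier V"
    unfolding simple_lie_module_def by blast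
  with v obtain b where b: "b \<in> B" "v = uea_act V b v" by blast
  then have "uea_act V 1 v = uea_act V b v" using uea_act_hom(5)[OF v] by simp
  then have "uea_act V (1 - b) v = \<zero>" by (simp only: uea_act_eq_iff[OF v])
  with b(1) show ?thesis by (rule bexI[rotated])
qed

section \<open>Adapted bases and the classification\<close>

lemma lie_hom_heis_incl: "lie_hom heis_incl"
  by (simp add: lie_hom_def plus_heisenberg.rep_eq cscale_heisenberg.rep_eq bracket_heisenberg.rep_eq)

text \<open>A homomorphism to an abelian Lie algebra kills \<open>z = [p, q]\<close>.\<close>

lemma lie_hom_heisenberg_eq:
  assumes "lie_hom \<phi>"
  shows "\<phi> x = co_p (heis_incl x) * \<phi> heis_p + co_q (heis_incl x) * \<phi> heis_q"
proof -
  have hom: "\<phi> (x + y) = \<phi> x + \<phi> y" "\<phi> (c *\<^sub>C x) = c * \<phi> x" "\<phi> (bracket x y) = 0" for x y c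
    using assms by (simp_all add: lie_hom_def cscale_complex_def bracket_complex_def)
  have "heis_z = bracket heis_p heis_q"
    by transfer (simp add: schroedinger_brackets)
  then have z: "\<phi> heis_z = 0" using hom(3)[of heis_p heis_q] by metis
  define s t r where "s = co_p (heis_incl x)" and "t = co_q (heis_incl x)" and "r = co_z (heis_incl x)"
  have "x = s *\<^sub>C heis_p + t *\<^sub>C heis_q + r *\<^sub>C heis_z"
  proof -
    have "heis_incl x = s *\<^sub>C sch_p + t *\<^sub>C sch_q + r *\<^sub>C sch_z"
      using heis_incl[of x] unfolding s_def t_def r_def mem_Collect_eq heisenberg_span_iff
      by (cases "heis_incl x")
        (simp add: sch_p_def sch_q_def sch_z_def plus_schroedinger_def cscale_schroedinger_def)
    then show ?thesis
      by (simp add: plus_heisenberg.rep_eq cscale_heisenberg.rep_eq heis_p.rep_eq heis_q.rep_eq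
          heis_z.rep_eq flip: heis_incl_inject)
  qed
  then have "\<phi> x = s * \<phi> heis_p + t * \<phi> heis_q + r * \<phi> heis_z"
    using hom by metis
  then show ?thesis
    by (simp add: z s_def t_def)
qed

text \<open>The image of the standard basis under the automorphism given by the matrix of determinant one that
  sends \<open>p\<close> to \<open>\<alpha> p + \<beta> q\<close> and \<open>q\<close> to \<open>a q - b p\<close>.  With \<open>a = \<phi> p\<close> and \<open>b = \<phi> q\<close>, the image
  of \<open>f\<close> is the element \<open>C\<close>.\<close>

lemma schroedinger_basis_rotated:
  assumes "\<alpha> * a + \<beta> * b = 1"
  shows "schroedinger_basis (Sch (\<alpha>\<^sup>2) (- (\<alpha> * \<beta>)) (- (\<beta>\<^sup>2)) 0 0 0)
    (Sch (2 * \<alpha> * b) (\<alpha> * a - \<beta> * b) (2 * \<beta> * a) 0 0 0)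
    (Sch (- (b\<^sup>2)) (- (a * b)) (a\<^sup>2) 0 0 0)
    (Sch 0 0 0 \<alpha> \<beta> 0) (Sch 0 0 0 (- b) a 0) (Sch 0 0 0 0 0 1)"
proof
  note defs = bracket_schroedinger_def cscale_schroedinger_def uminus_schroedinger_def
    zero_schroedinger_def plus_schroedinger_def
  let ?D = "\<alpha> * a + \<beta> * b"
  let ?e = "Sch (\<alpha>\<^sup>2) (- (\<alpha> * \<beta>)) (- (\<beta>\<^sup>2)) 0 0 0"
    and ?h = "Sch (2 * \<alpha> * b) (\<alpha> * a - \<beta> * b) (2 * \<beta> * a) 0 0 0"
    and ?f = "Sch (- (b\<^sup>2)) (- (a * b)) (a\<^sup>2) 0 0 0"
    and ?p = "Sch 0 0 0 \<alpha> \<beta> 0" and ?q = "Sch 0 0 0 (- b) a 0" and ?z = "Sch 0 0 0 0 0 1"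
  \<comment> \<open>Without assuming determinant one, each relation holds with the determinant as a factor.\<close>
  have "bracket ?h ?e = (2 * ?D) *\<^sub>C ?e" "bracket ?h ?f = (- 2 * ?D) *\<^sub>C ?f"
    "bracket ?e ?f = ?D *\<^sub>C ?h" "bracket ?h ?p = ?D *\<^sub>C ?p" "bracket ?h ?q = (- ?D) *\<^sub>C ?q"
    "bracket ?p ?q = ?D *\<^sub>C ?z" "bracket ?e ?q = ?D *\<^sub>C ?p" "bracket ?p ?f = (- ?D) *\<^sub>C ?q"
    "bracket ?f ?q = 0" "bracket ?e ?p = 0" "bracket ?z x = 0" for x
    by (simp_all add: defs power2_eq_square algebra_simps)
  then show "bracket ?h ?e = 2 *\<^sub>C ?e" "bracket ?h ?f = (- 2) *\<^sub>C ?f"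
    "bracket ?e ?f = ?h" "bracket ?h ?p = ?p" "bracket ?h ?q = - ?q"
    "bracket ?p ?q = ?z" "bracket ?e ?q = ?p" "bracket ?p ?f = - ?q"
    "bracket ?f ?q = 0" "bracket ?e ?p = 0" "bracket ?z x = 0" for x
    unfolding assms by (simp_all add: cscale_one) (simp_all add: defs)
  show "\<exists>c1 c2 c3 c4 c5 c6. x = c1 *\<^sub>C ?e + c2 *\<^sub>C ?h + c3 *\<^sub>C ?f
      + c4 *\<^sub>C ?p + c5 *\<^sub>C ?q + c6 *\<^sub>C ?z" for x
  proof (cases x)
    case (Sch e h f p q z)
    \<comment> \<open>The coefficients come from the inverse matrix, which expresses the old basis by the new one.\<close>
    define c1 c2 c3 where "c1 = a\<^sup>2 * e - 2 * a * b * h - b\<^sup>2 * f"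
      and "c2 = a * \<beta> * e + (\<alpha> * a - \<beta> * b) * h + \<alpha> * b * f"
      and "c3 = \<alpha>\<^sup>2 * f - \<beta>\<^sup>2 * e - 2 * \<alpha> * \<beta> * h"
    have "c1 * \<alpha>\<^sup>2 + c2 * (2 * \<alpha> * b) + c3 * (- (b\<^sup>2)) = e"
      using assms unfolding c1_def c2_def c3_def by Groebner_Basis.algebra
    moreover have "c1 * (- (\<alpha> * \<beta>)) + c2 * (\<alpha> * a - \<beta> * b) + c3 * (- (a * b)) = h"
      using assms unfolding c1_def c2_def c3_def by Groebner_Basis.algebra
    moreover have "c1 * (- (\<beta>\<^sup>2)) + c2 * (2 * \<beta> * a) + c3 * a\<^sup>2 = f"
      using assms unfolding c1_def c2_def c3_def by Groebner_Basis.algebra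
    moreover have "(a * p + b * q) * \<alpha> + (\<alpha> * q - \<beta> * p) * (- b) = p"
      using assms by Groebner_Basis.algebra
    moreover have "(a * p + b * q) * \<beta> + (\<alpha> * q - \<beta> * p) * a = q"
      using assms by Groebner_Basis.algebra
    ultimately have "x = c1 *\<^sub>C ?e + c2 *\<^sub>C ?h + c3 *\<^sub>C ?f + (a * p + b * q) *\<^sub>C ?p
        + (\<alpha> * q - \<beta> * p) *\<^sub>C ?q + z *\<^sub>C ?z"
      by (simp add: Sch cscale_schroedinger_def plus_schroedinger_def)
    then show ?thesis by blast
  qed
qed

theorem theorem4p3:
  fixes \<phi> :: "heisenberg \<Rightarrow> complex"
    and V :: "(schroedinger, 'v) lie_module"
  assumes "lie_hom \<phi>"
    and "\<phi> heis_p \<noteq> 0 \<or> \<phi> heis_q \<noteq> 0"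
    and "quasi_whittaker_module \<phi> V"
    and "simple_lie_module V"
  shows "\<exists>\<xi>. V \<cong>\<^sub>L qw_L \<phi> \<xi>"
proof -
  define a b where "a = \<phi> heis_p" and "b = \<phi> heis_q"
  obtain \<alpha> \<beta> where ab: "\<alpha> * a + \<beta> * b = 1"
  proof (cases "a = 0")
    case True
    then show ?thesis using that[of 0 "1 / b"] assms(2) by (auto simp: a_def b_def)
  next
    case False
    then show ?thesis using that[of "1 / a" 0] by simp
  qed
  interpret S: schroedinger_basis "Sch (\<alpha>\<^sup>2) (- (\<alpha> * \<beta>)) (- (\<beta>\<^sup>2)) 0 0 0"
    "Sch (2 * \<alpha> * b) (\<alpha> * a - \<beta> * b) (2 * \<beta> * a) 0 0 0"
    "Sch (- (b\<^sup>2)) (- (a * b)) (a\<^sup>2) 0 0 0"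
    "Sch 0 0 0 \<alpha> \<beta> 0" "Sch 0 0 0 (- b) a 0" "Sch 0 0 0 0 0 1"
    by (rule schroedinger_basis_rotated[OF ab])
  interpret M: induced_one_dim heis_incl \<phi>
    by (intro induced_one_dim.intro lie_hom_heis_incl assms(1))
  define J where "J = left_ideal hull M.gens"
  have J: "left_ideal J"
    unfolding J_def by (rule hull_in) (auto simp: left_ideal_def)
  have C: "qw_C \<phi> = S.F"
  proof -
    have "Sch (- (b\<^sup>2)) (- (a * b)) (a\<^sup>2) 0 0 0 =
        a\<^sup>2 *\<^sub>C sch_f + (- (b\<^sup>2)) *\<^sub>C sch_e + (- (a * b)) *\<^sub>C sch_h"
      by (simp add: sch_e_def sch_h_def sch_f_def plus_schroedinger_def cscale_schroedinger_def)
    then show ?thesis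
      by (simp only: uea_gen_add uea_gen_cscale uea_const_minus)
        (simp add: qw_C_def a_def b_def)
  qed
  have \<phi>: "\<phi> x = co_p (heis_incl x) * a + co_q (heis_incl x) * b" for x
    unfolding a_def b_def by (rule lie_hom_heisenberg_eq[OF assms(1)])
  have heis: "uea_gen (Sch 0 0 0 s t r) - uea_const (s * a + t * b) \<in> J" for s t r
  proof -
    have "heis_incl (Abs_heisenberg (Sch 0 0 0 s t r)) = Sch 0 0 0 s t r"
      by (rule Abs_heisenberg_inverse) (simp only: mem_Collect_eq heisenberg_span_iff, simp)
    then have "uea_gen (Sch 0 0 0 s t r) - uea_const (s * a + t * b) \<in> M.gens"
      by (intro range_eqI[of _ _ "Abs_heisenberg (Sch 0 0 0 s t r)"]) (simp add: \<phi>)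
    then show ?thesis unfolding J_def by (rule hull_inc)
  qed
  have J_gens: "S.P - 1 \<in> J" "S.Q \<in> J" "S.Z \<in> J"
    using heis[of \<alpha> \<beta> 0] heis[of "- b" a 0] heis[of 0 0 1]
    by (simp_all add: ab uea_const_1 uea_const_0 mult.commute)
  \<comment> \<open>An element \<open>x\<close> of the Heisenberg algebra is \<open>\<phi> x P + d Q + r Z\<close>, so \<open>P - 1\<close>, \<open>Q\<close> and \<open>Z\<close> generate \<open>J\<close>.\<close>
  have J_least: "J \<subseteq> A" if A: "left_ideal A" "S.P - 1 \<in> A" "S.Q \<in> A" "S.Z \<in> A" for A
  proof -
    have "M.gens \<subseteq> A"
    proof clarify
      fix x
      define s t r where "s = co_p (heis_incl x)" and "t = co_q (heis_incl x)" and "r = co_z (heis_incl x)"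
      have "heis_incl x = Sch 0 0 0 s t r"
        using heis_incl[of x] unfolding s_def t_def r_def mem_Collect_eq heisenberg_span_iff
        by (cases "heis_incl x") simp
      also have "\<dots> = (s * a + t * b) *\<^sub>C Sch 0 0 0 \<alpha> \<beta> 0 + (t * \<alpha> - s * \<beta>) *\<^sub>C Sch 0 0 0 (- b) a 0
          + r *\<^sub>C Sch 0 0 0 0 0 1"
        using ab by (simp add: plus_schroedinger_def cscale_schroedinger_def) (intro conjI; Groebner_Basis.algebra)
      finally have x: "heis_incl x = (s * a + t * b) *\<^sub>C Sch 0 0 0 \<alpha> \<beta> 0
          + (t * \<alpha> - s * \<beta>) *\<^sub>C Sch 0 0 0 (- b) a 0 + r *\<^sub>C Sch 0 0 0 0 0 1" .
      have "\<phi> x = s * a + t * b"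
        by (simp only: \<phi> s_def t_def)
      then have "uea_gen (heis_incl x) - uea_const (\<phi> x) =
          uea_const (s * a + t * b) * (S.P - 1) + uea_const (t * \<alpha> - s * \<beta>) * S.Q + uea_const r * S.Z"
        unfolding x uea_gen_add uea_gen_cscale by (simp add: right_diff_distrib)
      also have "\<dots> \<in> A"
        by (intro left_ideal_add left_ideal_mult A)
      finally show "uea_gen (heis_incl x) - uea_const (\<phi> x) \<in> A" .
    qed
    then show ?thesis unfolding J_def using A(1) by (rule hull_minimal)
  qed
  have M: "uea_presents (universal_qw_module \<phi>) (\<lambda>u. pure_tensor heis_incl (one_dim_module \<phi>) u 1) J"
    unfolding universal_qw_module_def J_def by (rule M.presents_induced_module)
  have L: "\<exists>\<pi>. uea_presents (qw_L \<phi> \<xi>) \<pi> {u. \<exists>r. u - r * (S.F - uea_const \<xi>) \<in> J}" for \<xi>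
    using uea_presents_cyclic_quotient[OF M J, of "S.F - uea_const \<xi>"]
    unfolding qw_L_def qw_W_def universal_qw_vector_def C uea_presents_act[OF M] by auto

  from assms(3) interpret V: lie_module V
    by (simp add: quasi_whittaker_module_def)
  from assms(3) obtain v where v: "v \<in> carrier V" "v \<noteq> \<zero>\<^bsub>V\<^esub>"
    and wh: "\<And>x. act V (heis_incl x) v = \<phi> x \<odot>\<^bsub>V\<^esub> v"
    and cyc: "carrier V = cyclic_submodule V v"
    by (auto simp: quasi_whittaker_module_def quasi_whittaker_vector_def)
  let ?A = "{u. uea_act V u v = \<zero>\<^bsub>V\<^esub>}"
  have A: "left_ideal ?A" by (rule V.left_ideal_annihilator[OF v(1)])
  have "M.gens \<subseteq> ?A"
  proof clarify
    fix x
    have "uea_act V (uea_gen (heis_incl x)) v = uea_act V (uea_const (\<phi> x)) v"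
      by (simp add: V.uea_act_hom v wh)
    then show "uea_act V (uea_gen (heis_incl x) - uea_const (\<phi> x)) v = \<zero>\<^bsub>V\<^esub>"
      by (simp only: V.uea_act_eq_iff[OF v(1)])
  qed
  then have "J \<subseteq> ?A"
    unfolding J_def using A by (rule hull_minimal)
  with J_gens have A_gens: "S.P - 1 \<in> ?A" "S.Q \<in> ?A" "S.Z \<in> ?A" by blast+
  have maximal: "1 \<in> B" if B: "left_ideal B" "?A \<subseteq> B" "b \<in> B" "b \<notin> ?A" for B b
  proof -
    obtain b' where "b' \<in> B" "1 - b' \<in> ?A"
      using V.simple_annihilator_maximal[OF v(1) cyc assms(4) B(1)] B by auto
    then show ?thesis
      using left_ideal_add[OF B(1), of "1 - b'" b'] B(2) by auto
  qed
  have one: "1 \<notin> ?A" using v by (simp add: V.uea_act_hom)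
  have "\<exists>y \<xi>. y \<notin> ?A \<and> S.whittaker_mod ?A y \<and> (S.F - uea_const \<xi>) * y \<in> ?A"
    by (rule S.exists_eigenvector[OF A one A_gens]) (rule maximal)
  \<comment> \<open>The generator \<open>v\<close> itself need not be an eigenvector of \<open>C\<close>; it is replaced by \<open>v' = y v\<close>.\<close>
  then obtain y \<xi> where y: "y \<notin> ?A" "S.whittaker_mod ?A y" "(S.F - uea_const \<xi>) * y \<in> ?A"
    by (elim exE conjE)
  define v' where "v' = uea_act V y v"
  have v': "v' \<in> carrier V" by (simp add: v'_def V.uea_act_closed v)
  let ?A' = "{u. uea_act V u v' = \<zero>\<^bsub>V\<^esub>}"
  have A'_iff: "u \<in> ?A' \<longleftrightarrow> u * y \<in> ?A" for u
    by (simp add: v'_def V.uea_act_hom v)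
  \<comment> \<open>By simplicity \<open>v'\<close> generates \<open>V\<close>.\<close>
  have cyc': "carrier V = cyclic_submodule V v'"
  proof
    have "1 \<in> {u. \<exists>r. u - r * y \<in> ?A}"
    proof (rule maximal[OF left_ideal_adjoin[OF A] _ _ y(1)])
      show "?A \<subseteq> {u. \<exists>r. u - r * y \<in> ?A}" by (auto intro!: exI[of _ 0])
      show "y \<in> {u. \<exists>r. u - r * y \<in> ?A}" using left_ideal_zero[OF A] by (auto intro!: exI[of _ 1])
    qed
    then obtain r where "1 - r * y \<in> ?A" by blast
    then have "uea_act V 1 v = uea_act V (r * y) v"
      by (simp only: V.uea_act_eq_iff[OF v(1)] mem_Collect_eq)
    then have r: "uea_act V r v' = v"
      by (simp add: V.uea_act_hom v v'_def)
    have "uea_act V u v = uea_act V (u * r) v'" for u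
      by (simp add: V.uea_act_hom v' r)
    then show "carrier V \<subseteq> cyclic_submodule V v'"
      using cyc by (auto simp: cyclic_submodule_def)
    show "cyclic_submodule V v' \<subseteq> carrier V"
      by (auto simp: cyclic_submodule_def V.uea_act_closed v')
  qed
  note presV' = V.uea_presents_cyclic[OF v' cyc']
  have A': "left_ideal ?A'" by (rule V.left_ideal_annihilator[OF v'])
  have A'_gens: "S.P - 1 \<in> ?A'" "S.Q \<in> ?A'" "S.Z \<in> ?A'" "S.F - uea_const \<xi> \<in> ?A'"
    using y unfolding A'_iff S.whittaker_mod_def by blast+
  let ?I = "{u. \<exists>r. u - r * (S.F - uea_const \<xi>) \<in> J}"
  \<comment> \<open>The annihilator of \<open>v'\<close> contains the kernel of \<open>L\<close>, which is maximal.\<close>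
  have "?A' = ?I"
  proof (rule S.maximal_left_ideal_eq)
    show I: "left_ideal ?I" by (rule left_ideal_adjoin[OF J])
    have "J \<subseteq> ?I" by (auto intro!: exI[of _ 0])
    with J_gens show "S.P - 1 \<in> ?I" "S.Q \<in> ?I" "S.Z \<in> ?I" by blast+
    show "S.F - uea_const \<xi> \<in> ?I"
      using left_ideal_zero[OF J] by (auto intro!: exI[of _ 1])
    show "left_ideal ?A'" by (rule A')
    show "1 \<notin> ?A'" using y(1) by (simp add: A'_iff del: mem_Collect_eq)
    show "?I \<subseteq> ?A'"
    proof
      fix u assume "u \<in> ?I"
      then obtain r where "u - r * (S.F - uea_const \<xi>) \<in> ?A'"
        using J_least[OF A' A'_gens(1-3)] by blast
      then show "u \<in> ?A'"
        using left_ideal_cong[OF A'] left_ideal_mult[OF A' A'_gens(4)] by blast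
    qed
  qed
  with presV' have "uea_presents V (\<lambda>u. uea_act V u v') ?I" by simp
  with L[of \<xi>] show ?thesis
    using presents_iso by blast
qed

end
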